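(* Let $\mathcal H$ be a real separable Hilbert space, let $J\subseteq\mathbb R$ be an interval, and let $\mathcal D=\{\mathcal V_t\}_{t\in J}$ be a family of closed subspaces of $\mathcal H$. Then, for all $k=0,1,\ldots,\infty,\omega$, $\mathcal D$ is a $C^k$ family of closed subspaces of $\mathcal H$ if and only if the map $t\mapsto P_{\mathcal V_t}$, from $J$ into $\mathrm L(\mathcal H)$, is of class $C^k$.
   Context: $\mathrm L(\mathcal H)$ is the Banach algebra of bounded linear operators on $\mathcal H$, $\mathrm{GL}(\mathcal H)$ its open subset of automorphisms, and $P_{\mathcal V}\in\mathrm L(\mathcal H)$ the orthogonal projection onto a closed subspace $\mathcal V$. $C^\omega$ means real analytic. A family $\{\mathcal V_t\}_{t\in J}$ of closed subspaces of $\mathcal H$ is a $C^k$ family of closed subspaces if for all $t_0\in J$ there exist $\varepsilon>0$, a $C^k$ map $\Psi:J\cap\left]t_0-\varepsilon,t_0+\varepsilon\right[\to\mathrm{GL}(\mathcal H)$ and a closed subspace $\mathcal V_\star\subseteq\mathcal H$ such that $\Psi_t(\mathcal V_t)=\mathcal V_\star$ for all $t\in J\cap\left]t_0-\varepsilon,t_0+\varepsilon\right[$. *)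

theory Defs
  imports "HOL-Analysis.Analysis"
begin

section \<open>Maps of class C^k on an interval\<close>

datatype smoothness = Fin nat | Infinity | Omega

text \<open>
  Derivatives are taken within \<open>J\<close>, hence are one-sided at endpoints belonging to \<open>J\<close>.
  \<open>D i\<close> is the \<open>i\<close>-th derivative of \<open>f\<close>.
\<close>

definition Cn_on :: "nat \<Rightarrow> real set \<Rightarrow> (real \<Rightarrow> 'b::real_normed_vector) \<Rightarrow> bool" where
  "Cn_on n J f \<longleftrightarrow>
     (\<exists>D :: nat \<Rightarrow> real \<Rightarrow> 'b.
        (\<forall>t\<in>J. D 0 t = f t) \<and>
        (\<forall>i<n. \<forall>t\<in>J. (D i has_vector_derivative D (Suc i) t) (at t within J)) \<and>
        continuous_on J (D n))"

text \<open>
  At an endpoint of \<open>J\<close> the power series represents \<open>f\<close> on the one-sided neighbourhood in \<open>J\<close>;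
  it then converges on a full neighbourhood, so this is the same as having a real analytic
  extension past the endpoint.
\<close>

definition real_analytic_map_on :: "real set \<Rightarrow> (real \<Rightarrow> 'b::real_normed_vector) \<Rightarrow> bool" where
  "real_analytic_map_on J f \<longleftrightarrow>
     (\<forall>t0\<in>J. \<exists>r>0. \<exists>a :: nat \<Rightarrow> 'b. \<forall>t \<in> J \<inter> {t0 - r<..<t0 + r}.
        (\<lambda>n. (t - t0) ^ n *\<^sub>R a n) sums f t)"

fun C_on :: "smoothness \<Rightarrow> real set \<Rightarrow> (real \<Rightarrow> 'b::real_normed_vector) \<Rightarrow> bool" where
  "C_on (Fin n) J f \<longleftrightarrow> Cn_on n J f"
| "C_on Infinity J f \<longleftrightarrow> (\<forall>n. Cn_on n J f)"
| "C_on Omega J f \<longleftrightarrow> real_analytic_map_on J f"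

section \<open>Operators and families of closed subspaces\<close>

definition GL :: "('a::real_normed_vector \<Rightarrow>\<^sub>L 'a) set" where
  "GL = {T. \<exists>S. S o\<^sub>L T = id_blinfun \<and> T o\<^sub>L S = id_blinfun}"

text \<open>
  Uniquely determined when \<open>V\<close> is a closed subspace of a Hilbert space; junk otherwise.
\<close>

definition orth_proj :: "'a::real_inner set \<Rightarrow> 'a \<Rightarrow>\<^sub>L 'a" where
  "orth_proj V = (THE P. \<forall>x. blinfun_apply P x \<in> V \<and> x - blinfun_apply P x \<in> V\<^sup>\<bottom>)"

definition closed_subspace :: "'a::real_normed_vector set \<Rightarrow> bool" where
  "closed_subspace V \<longleftrightarrow> subspace V \<and> closed V"

definition C_family_closed_subspaces ::
    "smoothness \<Rightarrow> real set \<Rightarrow> (real \<Rightarrow> 'a::real_normed_vector set) \<Rightarrow> bool" where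
  "C_family_closed_subspaces k J V \<longleftrightarrow>
     (\<forall>t\<in>J. closed_subspace (V t)) \<and>
     (\<forall>t0\<in>J. \<exists>\<epsilon>>0. \<exists>\<Psi> :: real \<Rightarrow> 'a \<Rightarrow>\<^sub>L 'a. \<exists>Vstar.
        (\<forall>t \<in> J \<inter> {t0 - \<epsilon><..<t0 + \<epsilon>}. \<Psi> t \<in> GL) \<and>
        C_on k (J \<inter> {t0 - \<epsilon><..<t0 + \<epsilon>}) \<Psi> \<and>
        closed_subspace Vstar \<and>
        (\<forall>t \<in> J \<inter> {t0 - \<epsilon><..<t0 + \<epsilon>}. blinfun_apply (\<Psi> t) ` V t = Vstar))"

end

theory Submission
  imports Defs
begin

text \<open>
  All smoothness classes are treated at once: the argument uses only that each class is preserved by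
  affine maps, by continuous bilinear products and by inversion of operators, implies continuity, and
  can be checked locally on an interval. These closure properties are \<open>C_on_affine\<close>, \<open>C_on_bilinear\<close>,
  \<open>C_on_inverse\<close>, \<open>C_on_imp_tendsto\<close> and \<open>C_on_glue\<close>. For finite order they come from induction on the
  order, for analytic maps from power series with geometrically bounded coefficients.

  If the orthogonal projections \<open>P_t\<close> are smooth, then
  \<open>\<Psi>_t = P_{t0} P_t + (1 - P_{t0}) (1 - P_t)\<close> is smooth, equals the identity at \<open>t0\<close>, hence is
  invertible near \<open>t0\<close>, and carries \<open>V_t\<close> onto \<open>V_{t0}\<close> (\<open>orth_proj_C_on_imp_family\<close>).

  Conversely, smooth automorphisms \<open>\<Psi>_t\<close> straightening the family give smooth, in general oblique,
  projections \<open>Q_t\<close> onto \<open>V_t\<close>, namely the conjugates by \<open>\<Psi>_t\<close> of one fixed projection onto the common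
  image. The orthogonal projection is recovered from an oblique one by
  \<open>P = Q (1 + Q - Q*)\<^sup>-\<^sup>1\<close> (\<open>orth_proj_from_idempotent\<close>). If the fixed projection is
  chosen so that \<open>Q_{t0} = P_{t0}\<close>, the operator to be inverted is the identity at \<open>t0\<close>, so it is
  invertible near \<open>t0\<close>, and \<open>P_t\<close> is smooth there (\<open>family_imp_orth_proj_C_on\<close>).
\<close>

section \<open>Calculus of finitely often differentiable maps\<close>

lemma Cn_on_0: "Cn_on 0 J f \<longleftrightarrow> continuous_on J f"
  unfolding Cn_on_def by (auto cong: continuous_on_cong)

text \<open>
  This recursion on the order replaces the explicit sequence of derivatives: the closure
  properties below follow from it by induction, each from the corresponding rule for first
  derivatives.
\<close>

lemma Cn_on_Suc:
  "Cn_on (Suc n) J f \<longleftrightarrow>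
     (\<exists>f'. (\<forall>t\<in>J. (f has_vector_derivative f' t) (at t within J)) \<and> Cn_on n J f')"
    (is "?L \<longleftrightarrow> ?R")
proof
  assume ?L
  then obtain D where D: "\<forall>t\<in>J. D 0 t = f t"
      "\<forall>i<Suc n. \<forall>t\<in>J. (D i has_vector_derivative D (Suc i) t) (at t within J)"
      "continuous_on J (D (Suc n))"
    unfolding Cn_on_def by blast
  have "(f has_vector_derivative D 1 t) (at t within J)" if "t \<in> J" for t
    using D(1,2) that by (auto intro: has_vector_derivative_transform[of t J f "D 0"])
  moreover have "Cn_on n J (D 1)"
    unfolding Cn_on_def using D(2,3) by (intro exI[of _ "\<lambda>i. D (Suc i)"]) auto
  ultimately show ?R by blast
next
  assume ?R
  then obtain f' D where f': "\<forall>t\<in>J. (f has_vector_derivative f' t) (at t within J)"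
    and D: "\<forall>t\<in>J. D 0 t = f' t"
      "\<forall>i<n. \<forall>t\<in>J. (D i has_vector_derivative D (Suc i) t) (at t within J)"
      "continuous_on J (D n)"
    unfolding Cn_on_def by blast
  show ?L
    unfolding Cn_on_def using f' D
    by (intro exI[of _ "\<lambda>i. case i of 0 \<Rightarrow> f | Suc j \<Rightarrow> D j"])
      (auto split: nat.split simp: less_Suc_eq_0_disj)
qed

lemma Cn_on_cong:
  assumes "\<And>t. t \<in> J \<Longrightarrow> f t = g t"
  shows "Cn_on n J f \<longleftrightarrow> Cn_on n J g"
  unfolding Cn_on_def using assms by auto

lemma Cn_on_imp_continuous_on: "Cn_on n J f \<Longrightarrow> continuous_on J f"
  by (cases n)
    (auto simp: Cn_on_0 Cn_on_Suc continuous_on_eq_continuous_within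
      intro: has_vector_derivative_continuous)

lemma Cn_on_Suc_imp: "Cn_on (Suc n) J f \<Longrightarrow> Cn_on n J f"
proof (induction n arbitrary: f)
  case 0
  then show ?case using Cn_on_0 Cn_on_imp_continuous_on by blast
next
  case (Suc n)
  then show ?case using Cn_on_Suc by metis
qed

lemma Cn_on_subset: "Cn_on n J f \<Longrightarrow> I \<subseteq> J \<Longrightarrow> Cn_on n I f"
proof (induction n arbitrary: f)
  case 0
  then show ?case using Cn_on_0 continuous_on_subset by blast
next
  case (Suc n)
  then obtain f' where f': "\<forall>t\<in>J. (f has_vector_derivative f' t) (at t within J)" "Cn_on n J f'"
    unfolding Cn_on_Suc by blast
  have "(f has_vector_derivative f' t) (at t within I)" if "t \<in> I" for t
    using f'(1) that Suc.prems(2) has_vector_derivative_within_subset[of f "f' t" t J I] by auto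
  then show ?case unfolding Cn_on_Suc using Suc.IH[OF f'(2) Suc.prems(2)] by blast
qed

lemma Cn_on_add: "Cn_on n J f \<Longrightarrow> Cn_on n J g \<Longrightarrow> Cn_on n J (\<lambda>t. f t + g t)"
proof (induction n arbitrary: f g)
  case 0
  then show ?case by (simp add: Cn_on_0 continuous_on_add)
next
  case (Suc n)
  from Suc.prems obtain f' g'
    where f': "\<forall>t\<in>J. (f has_vector_derivative f' t) (at t within J)" "Cn_on n J f'"
      and g': "\<forall>t\<in>J. (g has_vector_derivative g' t) (at t within J)" "Cn_on n J g'"
    unfolding Cn_on_Suc by blast
  show ?case unfolding Cn_on_Suc
  proof (intro exI conjI ballI)
    show "Cn_on n J (\<lambda>t. f' t + g' t)" using Suc.IH f'(2) g'(2) .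
    show "((\<lambda>t. f t + g t) has_vector_derivative f' t + g' t) (at t within J)" if "t \<in> J" for t
      using f'(1) g'(1) that by (intro has_vector_derivative_add) auto
  qed
qed

lemma Cn_on_linear:
  assumes "bounded_linear L" "Cn_on n J f"
  shows "Cn_on n J (\<lambda>t. L (f t))"
  using assms(2)
proof (induction n arbitrary: f)
  case 0
  then show ?case
    using assms(1) by (simp add: Cn_on_0 bounded_linear.continuous_on)
next
  case (Suc n)
  then obtain f' where f': "\<forall>t\<in>J. (f has_vector_derivative f' t) (at t within J)" "Cn_on n J f'"
    unfolding Cn_on_Suc by blast
  show ?case unfolding Cn_on_Suc
  proof (intro exI conjI ballI)
    show "Cn_on n J (\<lambda>t. L (f' t))" using Suc.IH f'(2) .
    show "((\<lambda>t. L (f t)) has_vector_derivative L (f' t)) (at t within J)" if "t \<in> J" for t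
      using f'(1) that by (intro bounded_linear.has_vector_derivative[OF assms(1)]) auto
  qed
qed

lemma Cn_on_affine:
  assumes "bounded_linear L" "Cn_on n J f"
  shows "Cn_on n J (\<lambda>t. c + L (f t))"
proof (cases n)
  case 0
  then show ?thesis
    using assms by (auto simp: Cn_on_0 intro!: continuous_on_add bounded_linear.continuous_on[OF assms(1)])
next
  case (Suc m)
  from Cn_on_linear[OF assms] obtain f'
    where f': "\<forall>t\<in>J. ((\<lambda>t. L (f t)) has_vector_derivative f' t) (at t within J)" "Cn_on m J f'"
    unfolding Suc Cn_on_Suc by blast
  have "((\<lambda>t. c + L (f t)) has_vector_derivative f' t) (at t within J)" if "t \<in> J" for t
    using has_vector_derivative_add[OF has_vector_derivative_const[of c] bspec[OF f'(1) that]]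
    by simp
  then show ?thesis unfolding Suc Cn_on_Suc using f'(2) by blast
qed

lemma Cn_on_bilinear:
  assumes "bounded_bilinear B" "Cn_on n J f" "Cn_on n J g"
  shows "Cn_on n J (\<lambda>t. B (f t) (g t))"
  using assms(2,3)
proof (induction n arbitrary: f g)
  case 0
  then show ?case
    using assms(1) by (simp add: Cn_on_0 bounded_bilinear.continuous_on)
next
  case (Suc n)
  from Suc.prems obtain f' g'
    where f': "\<forall>t\<in>J. (f has_vector_derivative f' t) (at t within J)" "Cn_on n J f'"
      and g': "\<forall>t\<in>J. (g has_vector_derivative g' t) (at t within J)" "Cn_on n J g'"
    unfolding Cn_on_Suc by blast
  have "Cn_on n J (\<lambda>t. B (f t) (g' t) + B (f' t) (g t))"
    using Suc.IH[OF Cn_on_Suc_imp[OF Suc.prems(1)] g'(2)]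
      Suc.IH[OF f'(2) Cn_on_Suc_imp[OF Suc.prems(2)]] Cn_on_add by blast
  moreover have "((\<lambda>t. B (f t) (g t)) has_vector_derivative B (f t) (g' t) + B (f' t) (g t))
      (at t within J)" if "t \<in> J" for t
    using bounded_bilinear.has_vector_derivative[OF assms(1)] f'(1) g'(1) that by blast
  ultimately show ?case unfolding Cn_on_Suc
    by (intro exI[of _ "\<lambda>t. B (f t) (g' t) + B (f' t) (g t)"]) simp
qed

text \<open>
  The resolvent identity. Continuity and differentiability of inversion both rest on it, because it
  expresses the increment of the inverse by the increment of the operator.
\<close>

lemma inverse_diff_blinfun:
  assumes "g o\<^sub>L f = id_blinfun" "f' o\<^sub>L g' = id_blinfun"
  shows "g - g' = g o\<^sub>L (f' - f) o\<^sub>L g'"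
proof (rule blinfun_eqI)
  fix x
  have "g (f y) = y" for y
    using assms(1) by (metis blinfun_apply_blinfun_compose blinfun_apply_id_blinfun)
  moreover have "f' (g' y) = y" for y
    using assms(2) by (metis blinfun_apply_blinfun_compose blinfun_apply_id_blinfun)
  ultimately show "(g - g') x = (g o\<^sub>L (f' - f) o\<^sub>L g') x"
    by (simp add: blinfun.diff_left blinfun.diff_right)
qed

text \<open>
  Once \<open>f t\<close> is close to \<open>f0\<close>, the resolvent identity bounds \<open>norm (g t)\<close> by \<open>2 * norm g0\<close>:
  half of \<open>norm (g t)\<close> can be absorbed on the left-hand side. Inserting this bound into the identity
  makes \<open>g t - g0\<close> of the order of \<open>f0 - f t\<close>.
\<close>

lemma tendsto_inverse_blinfun:
  assumes f: "(f \<longlongrightarrow> f0) F"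
    and g: "eventually (\<lambda>t. g t o\<^sub>L f t = id_blinfun) F"
    and g0: "f0 o\<^sub>L g0 = id_blinfun"
  shows "(g \<longlongrightarrow> g0) F"
proof -
  have small: "eventually (\<lambda>t. norm (f0 - f t) * norm g0 < 1 / 2) F"
  proof -
    have "((\<lambda>t. norm (f0 - f t) * norm g0) \<longlongrightarrow> norm (f0 - f0) * norm g0) F"
      by (intro tendsto_intros f)
    then show ?thesis by (rule order_tendstoD) simp
  qed
  have bound: "norm (g t - g0) \<le> 2 * norm g0 * (norm (f0 - f t) * norm g0)"
    if t: "g t o\<^sub>L f t = id_blinfun" and s: "norm (f0 - f t) * norm g0 < 1 / 2" for t
  proof -
    have *: "norm (g t - g0) \<le> norm (g t) * (norm (f0 - f t) * norm g0)"
    proof -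
      have "norm (g t o\<^sub>L (f0 - f t) o\<^sub>L g0) \<le> norm (g t o\<^sub>L (f0 - f t)) * norm g0"
        by (rule norm_blinfun_compose)
      also have "\<dots> \<le> norm (g t) * norm (f0 - f t) * norm g0"
        by (intro mult_right_mono norm_blinfun_compose norm_ge_zero)
      finally show ?thesis unfolding inverse_diff_blinfun[OF t g0] by (simp only: mult.assoc)
    qed
    also have "\<dots> \<le> norm (g t) * (1 / 2)"
      using s by (intro mult_left_mono) auto
    finally have "norm (g t) \<le> 2 * norm g0"
      using norm_triangle_sub[of "g t" g0] by linarith
    then have "norm (g t) * (norm (f0 - f t) * norm g0)
        \<le> 2 * norm g0 * (norm (f0 - f t) * norm g0)"
      by (intro mult_right_mono) auto
    then show ?thesis using * by (rule order_trans[rotated])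
  qed
  have lim: "((\<lambda>t. 2 * norm g0 * (norm (f0 - f t) * norm g0)) \<longlongrightarrow>
      2 * norm g0 * (norm (f0 - f0) * norm g0)) F"
    by (intro tendsto_intros f)
  have "((\<lambda>t. g t - g0) \<longlongrightarrow> 0) F"
  proof (rule Lim_null_comparison)
    show "\<forall>\<^sub>F t in F. norm (g t - g0) \<le> 2 * norm g0 * (norm (f0 - f t) * norm g0)"
      using g small by eventually_elim (rule bound)
    show "((\<lambda>t. 2 * norm g0 * (norm (f0 - f t) * norm g0)) \<longlongrightarrow> 0) F"
      using lim by simp
  qed
  then show ?thesis by (rule LIM_zero_cancel)
qed

lemma has_vector_derivative_within_quotient:
  "(f has_vector_derivative D) (at t within S) \<longleftrightarrow>
     ((\<lambda>s. (1 / (s - t)) *\<^sub>R (f s - f t)) \<longlongrightarrow> D) (at t within S)"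
proof -
  have eq: "norm ((f s - f t - (s - t) *\<^sub>R D) /\<^sub>R norm (s - t))
      = norm ((1 / (s - t)) *\<^sub>R (f s - f t) - D)" if "s \<noteq> t" for s
  proof -
    have "(1 / (s - t)) *\<^sub>R (f s - f t) - D = (1 / (s - t)) *\<^sub>R (f s - f t - (s - t) *\<^sub>R D)"
      using that by (simp add: scaleR_diff_right)
    then show ?thesis by (simp add: divide_inverse)
  qed
  have "((\<lambda>s. (f s - f t - (s - t) *\<^sub>R D) /\<^sub>R norm (s - t)) \<longlongrightarrow> 0) (at t within S)
      \<longleftrightarrow> ((\<lambda>s. norm ((f s - f t - (s - t) *\<^sub>R D) /\<^sub>R norm (s - t))) \<longlongrightarrow> 0) (at t within S)"
    by (rule tendsto_norm_zero_iff[symmetric])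
  also have "\<dots> \<longleftrightarrow> ((\<lambda>s. norm ((1 / (s - t)) *\<^sub>R (f s - f t) - D)) \<longlongrightarrow> 0) (at t within S)"
    by (rule filterlim_cong[OF refl refl], unfold eventually_at_filter, rule always_eventually)
      (use eq in blast)
  also have "\<dots> \<longleftrightarrow> ((\<lambda>s. (1 / (s - t)) *\<^sub>R (f s - f t)) \<longlongrightarrow> D) (at t within S)"
    unfolding tendsto_norm_zero_iff LIM_zero_iff ..
  finally show ?thesis
    by (simp add: has_vector_derivative_def has_derivative_within bounded_linear_scaleR_left
        inverse_eq_divide diff_diff_add)
qed

text \<open>
  The resolvent identity writes the difference quotient of \<open>g\<close> as minus the difference quotient of
  \<open>f\<close>, multiplied by \<open>g s\<close> on the left and by \<open>g t\<close> on the right, and \<open>g s\<close> tends to \<open>g t\<close>.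
\<close>

lemma has_vector_derivative_inverse_blinfun:
  assumes f: "(f has_vector_derivative f') (at t within J)" and t: "t \<in> J"
    and g: "\<And>s. s \<in> J \<Longrightarrow> g s o\<^sub>L f s = id_blinfun"
    and g': "\<And>s. s \<in> J \<Longrightarrow> f s o\<^sub>L g s = id_blinfun"
  shows "(g has_vector_derivative - (g t o\<^sub>L f' o\<^sub>L g t)) (at t within J)"
proof -
  have ev: "eventually (\<lambda>s. s \<in> J) (at t within J)"
    by (simp add: eventually_at_filter)
  have "(g \<longlongrightarrow> g t) (at t within J)"
    using has_vector_derivative_continuous[OF f] g g' t ev
    by (intro tendsto_inverse_blinfun[of f "f t"])
      (auto simp: continuous_within intro: eventually_mono)
  then have "((\<lambda>s. - (g s o\<^sub>L ((1 / (s - t)) *\<^sub>R (f s - f t)) o\<^sub>L g t))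
      \<longlongrightarrow> - (g t o\<^sub>L f' o\<^sub>L g t)) (at t within J)"
    using f unfolding has_vector_derivative_within_quotient by (intro tendsto_intros)
  moreover have "- (g s o\<^sub>L ((1 / (s - t)) *\<^sub>R (f s - f t)) o\<^sub>L g t)
      = (1 / (s - t)) *\<^sub>R (g s - g t)" if "s \<in> J" for s
    unfolding inverse_diff_blinfun[OF g[OF that] g'[OF t]]
    by (rule blinfun_eqI)
      (simp add: blinfun.bilinear_simps scaleR_diff_right)
  ultimately show ?thesis
    unfolding has_vector_derivative_within_quotient
    by (auto elim!: Lim_transform_eventually intro: eventually_mono[OF ev])
qed

text \<open>
  The derivative \<open>- g f' g\<close> is a product of factors that are already known to be one order less
  smooth, so the induction on the order closes.
\<close>

lemma Cn_on_inverse: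
  assumes "Cn_on n J f"
    and g: "\<And>s. s \<in> J \<Longrightarrow> g s o\<^sub>L f s = id_blinfun"
    and g': "\<And>s. s \<in> J \<Longrightarrow> f s o\<^sub>L g s = id_blinfun"
  shows "Cn_on n J g"
  using assms(1)
proof (induction n)
  case 0
  show ?case unfolding Cn_on_0 continuous_on_def
  proof
    fix t assume t: "t \<in> J"
    then have "(f \<longlongrightarrow> f t) (at t within J)"
      using 0 by (auto simp: Cn_on_0 continuous_on_def)
    then show "(g \<longlongrightarrow> g t) (at t within J)"
      by (rule tendsto_inverse_blinfun) (use g g' t in \<open>auto simp: eventually_at_filter\<close>)
  qed
next
  case (Suc n)
  then obtain f' where f': "\<forall>t\<in>J. (f has_vector_derivative f' t) (at t within J)" "Cn_on n J f'"
    unfolding Cn_on_Suc by blast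
  have "Cn_on n J g" using Suc Cn_on_Suc_imp by blast
  then have "Cn_on n J (\<lambda>t. - (g t o\<^sub>L f' t o\<^sub>L g t))"
    by (intro Cn_on_linear[OF bounded_linear_minus[OF bounded_linear_ident]]
        Cn_on_bilinear[OF bounded_bilinear_blinfun_compose] f'(2))
  moreover have "(g has_vector_derivative - (g t o\<^sub>L f' t o\<^sub>L g t)) (at t within J)"
    if "t \<in> J" for t
    by (rule has_vector_derivative_inverse_blinfun[OF bspec[OF f'(1) that] that g g'])
  ultimately show ?case unfolding Cn_on_Suc
    by (intro exI[of _ "\<lambda>t. - (g t o\<^sub>L f' t o\<^sub>L g t)"]) simp
qed

lemma Cn_on_singleton: "Cn_on n {c} f"
proof -
  have "(f has_vector_derivative f t) (at t within {c})" if "t \<in> {c}" for t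
    unfolding has_vector_derivative_within_quotient
    using that by (simp add: at_within_eq_bot_iff[THEN iffD2])
  then show ?thesis unfolding Cn_on_def by (intro exI[of _ "\<lambda>_. f"]) auto
qed

text \<open>
  Local derivatives fit together because a derivative within a nondegenerate interval is unique; the
  derivative within the whole interval then agrees near each point with the local one. At a
  degenerate interval uniqueness fails, but there every map is smooth.
\<close>

lemma Cn_on_glue:
  assumes "is_interval J"
    and "\<And>t0. t0 \<in> J \<Longrightarrow> \<exists>e>0. Cn_on n (J \<inter> {t0 - e<..<t0 + e}) f"
  shows "Cn_on n J f"
proof (cases "\<exists>c. J = {c}")
  case True
  then show ?thesis using Cn_on_singleton by blast
next
  case False
  have nontriv: "at t within J \<noteq> bot" if "t \<in> J" for t
    using connected_imp_perfect[OF is_interval_connected[OF assms(1)] that] False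
    by (auto simp: trivial_limit_within)
  have within: "at t within (J \<inter> {t0 - e<..<t0 + e}) = at t within J"
    if "t \<in> {t0 - e<..<t0 + e}" for t t0 e :: real
    by (rule at_within_nhd[of _ "{t0 - e<..<t0 + e}"]) (use that in auto)
  show ?thesis using assms(2)
  proof (induction n arbitrary: f)
    case 0
    show ?case unfolding Cn_on_0 continuous_on_def
    proof
      fix t assume t: "t \<in> J"
      then obtain e where e: "e > 0" "continuous_on (J \<inter> {t - e<..<t + e}) f"
        using 0 unfolding Cn_on_0 by blast
      then have "(f \<longlongrightarrow> f t) (at t within (J \<inter> {t - e<..<t + e}))"
        using t unfolding continuous_on_def by auto
      then show "(f \<longlongrightarrow> f t) (at t within J)" using within[of t t e] e(1) by simp
    qed
  next
    case (Suc n)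
    define f' where "f' t = vector_derivative f (at t within J)" for t
    have f'_eq: "f' t = d" if "(f has_vector_derivative d) (at t within J)" "t \<in> J" for t d
      unfolding f'_def by (rule vector_derivative_within) (use nontriv that in auto)
    have loc: "(\<exists>e>0. Cn_on n (J \<inter> {t0 - e<..<t0 + e}) f')
        \<and> (f has_vector_derivative f' t0) (at t0 within J)" if t0: "t0 \<in> J" for t0
    proof -
      obtain e where e: "e > 0" "Cn_on (Suc n) (J \<inter> {t0 - e<..<t0 + e}) f"
        using Suc.prems t0 by blast
      then obtain d where d: "Cn_on n (J \<inter> {t0 - e<..<t0 + e}) d"
        "\<forall>t\<in>J \<inter> {t0 - e<..<t0 + e}. (f has_vector_derivative d t)
           (at t within (J \<inter> {t0 - e<..<t0 + e}))"
        unfolding Cn_on_Suc by blast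
      have d': "(f has_vector_derivative d t) (at t within J)"
        if "t \<in> J \<inter> {t0 - e<..<t0 + e}" for t
        using bspec[OF d(2) that] within[of t t0 e] that by simp
      then have eq: "f' t = d t" if "t \<in> J \<inter> {t0 - e<..<t0 + e}" for t
        using that f'_eq by blast
      have "Cn_on n (J \<inter> {t0 - e<..<t0 + e}) f'"
        using d(1) Cn_on_cong[of "J \<inter> {t0 - e<..<t0 + e}" f' d n] eq by simp
      moreover have "(f has_vector_derivative f' t0) (at t0 within J)"
        using d'[of t0] eq[of t0] t0 e(1) by simp
      ultimately show ?thesis using e(1) by blast
    qed
    then have "Cn_on n J f'" using Suc.IH by blast
    then show ?case unfolding Cn_on_Suc using loc by blast
  qed
qed

section \<open>Calculus of real analytic maps\<close>

text \<open>
  A convergent power series with its coefficient bound made explicit. The bound turns local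
  convergence in a normed space into geometric domination, which is what products and reciprocals of
  series require.
\<close>

definition power_expansion ::
    "real set \<Rightarrow> (real \<Rightarrow> 'b::real_normed_vector) \<Rightarrow> real \<Rightarrow> (nat \<Rightarrow> 'b) \<Rightarrow> real \<Rightarrow> real \<Rightarrow> bool" where
  "power_expansion J f t0 a r C \<longleftrightarrow>
     0 < r \<and> (\<forall>n. norm (a n) * r ^ n \<le> C) \<and>
     (\<forall>t\<in>J. \<bar>t - t0\<bar> < r \<longrightarrow> (\<lambda>n. (t - t0) ^ n *\<^sub>R a n) sums f t)"

text \<open>
  Convergence at a single point \<open>t1 \<noteq> t0\<close> bounds the terms at \<open>t1\<close>, hence \<open>\<bar>t1 - t0\<bar>\<close> can serve as the
  radius. If the domain has no such point near \<open>t0\<close>, the series of a constant does.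
\<close>

lemma real_analytic_imp_power_expansion:
  assumes "real_analytic_map_on J f" "t0 \<in> J"
  obtains a r C where "power_expansion J f t0 a r C"
proof -
  obtain r a where r: "r > 0"
    and sums: "\<And>t. t \<in> J \<Longrightarrow> \<bar>t - t0\<bar> < r \<Longrightarrow> (\<lambda>n. (t - t0) ^ n *\<^sub>R a n) sums f t"
    using assms unfolding real_analytic_map_on_def by (fastforce simp: abs_less_iff)
  show thesis
  proof (cases "\<exists>t1\<in>J. t1 \<noteq> t0 \<and> \<bar>t1 - t0\<bar> < r")
    case True
    then obtain t1 where t1: "t1 \<in> J" "t1 \<noteq> t0" "\<bar>t1 - t0\<bar> < r" by blast
    have "(\<lambda>n. (t1 - t0) ^ n *\<^sub>R a n) \<longlonglongrightarrow> 0"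
      using sums[OF t1(1,3)] by (intro summable_LIMSEQ_zero) (rule sums_summable)
    then have "Bseq (\<lambda>n. (t1 - t0) ^ n *\<^sub>R a n)"
      using convergent_imp_Bseq convergentI by blast
    then obtain C where "\<And>n. norm ((t1 - t0) ^ n *\<^sub>R a n) \<le> C"
      unfolding Bseq_def by blast
    then have "power_expansion J f t0 a \<bar>t1 - t0\<bar> C"
      unfolding power_expansion_def using t1 sums
      by (auto simp: power_abs mult.commute)
    then show ?thesis by (rule that)
  next
    case False
    have "(\<lambda>n. (t - t0) ^ n *\<^sub>R (if n = 0 then f t0 else 0)) sums f t" if "t = t0" for t
    proof -
      have "(\<lambda>n. (t - t0) ^ n *\<^sub>R (if n = 0 then f t0 else 0)) = (\<lambda>n. if n = 0 then f t0 else 0)"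
        by auto
      then show ?thesis using sums_single[of 0 "\<lambda>n. f t0"] that by simp
    qed
    then have "power_expansion J f t0 (\<lambda>n. if n = 0 then f t0 else 0) r (norm (f t0))"
      unfolding power_expansion_def using False r by auto
    then show ?thesis by (rule that)
  qed
qed

lemma real_analyticI:
  assumes "\<And>t0. t0 \<in> J \<Longrightarrow> \<exists>r>0. \<exists>a. \<forall>t\<in>J. \<bar>t - t0\<bar> < r \<longrightarrow> (\<lambda>n. (t - t0) ^ n *\<^sub>R a n) sums f t"
  shows "real_analytic_map_on J f"
  unfolding real_analytic_map_on_def
proof
  fix t0 assume "t0 \<in> J"
  then obtain r a where "r > 0"
    "\<forall>t\<in>J. \<bar>t - t0\<bar> < r \<longrightarrow> (\<lambda>n. (t - t0) ^ n *\<^sub>R a n) sums f t"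
    using assms by blast
  then show "\<exists>r>0. \<exists>a. \<forall>t\<in>J \<inter> {t0 - r<..<t0 + r}. (\<lambda>n. (t - t0) ^ n *\<^sub>R a n) sums f t"
    by (intro exI[of _ r] conjI exI[of _ a]) (auto simp: abs_less_iff)
qed

lemma power_expansion_shrink:
  assumes "power_expansion J f t0 a r C" "0 < r'" "r' \<le> r"
  shows "power_expansion J f t0 a r' C"
proof -
  have "norm (a n) * r' ^ n \<le> norm (a n) * r ^ n" for n
    using assms by (intro mult_left_mono power_mono) auto
  then have "norm (a n) * r' ^ n \<le> C" for n
    using assms(1) order_trans unfolding power_expansion_def by blast
  then show ?thesis
    using assms unfolding power_expansion_def by auto
qed

lemma power_expansion_0:
  assumes "power_expansion J f t0 a r C" "t0 \<in> J"
  shows "f t0 = a 0"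
proof -
  have "(\<lambda>n. 0 ^ n *\<^sub>R a n) sums f t0"
    using assms unfolding power_expansion_def by auto
  moreover have "(\<lambda>n. 0 ^ n *\<^sub>R a n) = (\<lambda>n. if n = 0 then a n else 0)" by auto
  ultimately show ?thesis using sums_single[of 0 a] sums_unique2 by metis
qed

lemma norm_term_le:
  fixes x :: "'b::real_normed_vector"
  assumes "norm x * r ^ n \<le> C" "0 < r"
  shows "norm (s ^ n *\<^sub>R x) \<le> C * (\<bar>s\<bar> / r) ^ n"
proof -
  have "norm (s ^ n *\<^sub>R x) = (norm x * r ^ n) * (\<bar>s\<bar> / r) ^ n"
    using assms(2) by (simp add: power_divide power_abs)
  also have "\<dots> \<le> C * (\<bar>s\<bar> / r) ^ n"
    using assms by (intro mult_right_mono) auto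
  finally show ?thesis .
qed

lemma power_expansion_summable_norm:
  fixes a :: "nat \<Rightarrow> 'b::real_normed_vector"
  assumes "\<And>n. norm (a n) * r ^ n \<le> C" "0 < r" "\<bar>s\<bar> < r"
  shows "summable (\<lambda>n. norm (s ^ n *\<^sub>R a n))"
proof (rule summable_comparison_test)
  show "\<exists>N. \<forall>n\<ge>N. norm (norm (s ^ n *\<^sub>R a n)) \<le> C * (\<bar>s\<bar> / r) ^ n"
    using norm_term_le[OF assms(1,2)] by simp
  show "summable (\<lambda>n. C * (\<bar>s\<bar> / r) ^ n)"
    using assms by (intro summable_mult summable_geometric) auto
qed

text \<open>
  The tail of the series after its constant term is dominated by \<open>C * (q + q\<^sup>2 + \<dots>)\<close> with
  \<open>q = \<bar>t - t0\<bar> / r\<close>, which vanishes as \<open>t\<close> tends to \<open>t0\<close>.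
\<close>

lemma power_expansion_imp_tendsto:
  assumes "power_expansion J f t0 a r C" "t0 \<in> J"
  shows "(f \<longlongrightarrow> f t0) (at t0 within J)"
proof -
  have r: "r > 0" and bd: "\<And>n. norm (a n) * r ^ n \<le> C"
    and sums: "\<And>t. t \<in> J \<Longrightarrow> \<bar>t - t0\<bar> < r \<Longrightarrow> (\<lambda>n. (t - t0) ^ n *\<^sub>R a n) sums f t"
    using assms(1) unfolding power_expansion_def by auto
  have est: "norm (f t - f t0) \<le> C * (\<bar>t - t0\<bar> / r / (1 - \<bar>t - t0\<bar> / r))"
    if t: "t \<in> J" "\<bar>t - t0\<bar> < r" for t
  proof -
    define q where "q = \<bar>t - t0\<bar> / r"
    have q: "0 \<le> q" "q < 1" using t(2) r by (auto simp: q_def)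
    have C: "C \<ge> 0" using order_trans[OF norm_ge_zero bd[of 0, simplified]] .
    have "(\<lambda>n. (t - t0) ^ Suc n *\<^sub>R a (Suc n)) sums (f t - f t0)"
      using sums_Suc_iff[of "\<lambda>n. (t - t0) ^ n *\<^sub>R a n" "f t - f t0"] sums[OF t]
        power_expansion_0[OF assms] by simp
    then have lim: "(\<lambda>N. norm (\<Sum>n<N. (t - t0) ^ Suc n *\<^sub>R a (Suc n))) \<longlonglongrightarrow> norm (f t - f t0)"
      unfolding sums_def by (rule tendsto_norm)
    have geo: "(\<lambda>n. C * q * q ^ n) sums (C * q * (1 / (1 - q)))"
      using q by (intro sums_mult geometric_sums) auto
    have "norm (\<Sum>n<N. (t - t0) ^ Suc n *\<^sub>R a (Suc n)) \<le> C * q * (1 / (1 - q))" for N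
    proof -
      have "norm (\<Sum>n<N. (t - t0) ^ Suc n *\<^sub>R a (Suc n)) \<le> (\<Sum>n<N. C * q ^ Suc n)"
        unfolding q_def by (intro sum_norm_le norm_term_le bd r)
      also have "\<dots> = (\<Sum>n<N. C * q * q ^ n)" by (simp add: mult.assoc)
      also have "\<dots> \<le> C * q * (1 / (1 - q))"
        using geo C q by (subst sums_unique[OF geo]) (intro sum_le_suminf; auto intro: sums_summable)
      finally show ?thesis .
    qed
    then show ?thesis
      using LIMSEQ_le_const2[OF lim] by (auto simp: q_def)
  qed
  have lim: "((\<lambda>t. C * (\<bar>t - t0\<bar> / r / (1 - \<bar>t - t0\<bar> / r))) \<longlongrightarrow>
      C * (\<bar>t0 - t0\<bar> / r / (1 - \<bar>t0 - t0\<bar> / r))) (at t0 within J)"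
    using r by (intro tendsto_intros) auto
  have "((\<lambda>t. f t - f t0) \<longlongrightarrow> 0) (at t0 within J)"
  proof (rule Lim_null_comparison)
    show "\<forall>\<^sub>F t in at t0 within J. norm (f t - f t0) \<le> C * (\<bar>t - t0\<bar> / r / (1 - \<bar>t - t0\<bar> / r))"
      unfolding eventually_at using est r by (intro exI[of _ r]) (auto simp: dist_real_def)
    show "((\<lambda>t. C * (\<bar>t - t0\<bar> / r / (1 - \<bar>t - t0\<bar> / r))) \<longlongrightarrow> 0) (at t0 within J)"
      using lim by simp
  qed
  then show ?thesis by (rule LIM_zero_cancel)
qed

lemma sum_square_diff_triangle:
  fixes h :: "nat \<Rightarrow> nat \<Rightarrow> 'z::real_normed_vector"
  shows "(\<Sum>i<N. \<Sum>j<N. h i j) - (\<Sum>k<N. \<Sum>i\<le>k. h i (k - i))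
    = (\<Sum>(i,j)\<in>{(i, j). i < N \<and> j < N \<and> N \<le> i + j}. h i j)" (is "_ = sum _ ?S")
proof -
  have "(\<Sum>i<N. \<Sum>j<N. h i j) = (\<Sum>(i,j)\<in>{..<N} \<times> {..<N}. h i j)"
    by (simp add: sum.cartesian_product)
  also have "\<dots> = (\<Sum>(i,j)\<in>{(i,j). i + j < N} \<union> ?S. h i j)"
    by (rule sum.cong) auto
  also have "\<dots> = (\<Sum>(i,j)\<in>{(i,j). i + j < N}. h i j) + (\<Sum>(i,j)\<in>?S. h i j)"
  proof (rule sum.union_disjoint)
    show "finite {(i, j). i + j < N}" "finite ?S"
      by (rule finite_subset[of _ "{..<N} \<times> {..<N}"]; auto)+
  qed auto
  finally show ?thesis by (simp add: sum.triangle_reindex)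
qed

text \<open>
  The product of two partial sums and the partial sum of the Cauchy product differ by the terms in
  the upper triangle of the index square. Their norms add up to at most a multiple of the same
  difference for the real series of norms, which tends to zero by the Cauchy product theorem for
  real series. Only partial sums are compared, so the lemma also applies while the convergence of
  one of the series is still to be established, as for the reciprocal series below.
\<close>

lemma Cauchy_product_bilinear:
  fixes a :: "nat \<Rightarrow> 'a::real_normed_vector" and b :: "nat \<Rightarrow> 'b::real_normed_vector"
    and B :: "'a \<Rightarrow> 'b \<Rightarrow> 'c::real_normed_vector"
  assumes B: "bounded_bilinear B"
    and a: "summable (\<lambda>k. norm (a k))" and b: "summable (\<lambda>k. norm (b k))"
  shows "(\<lambda>N. B (\<Sum>k<N. a k) (\<Sum>k<N. b k) - (\<Sum>k<N. \<Sum>i\<le>k. B (a i) (b (k - i)))) \<longlonglongrightarrow> 0"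
proof -
  interpret bounded_bilinear B by (rule B)
  obtain K where K: "\<And>x y. norm (B x y) \<le> norm x * norm y * K" using bounded by blast
  define S where "S N = {(i, j). i < N \<and> j < N \<and> N \<le> i + j}" for N :: nat
  have "(\<lambda>N. (\<Sum>k<N. norm (a k)) * (\<Sum>k<N. norm (b k))
      - (\<Sum>k<N. \<Sum>i\<le>k. norm (a i) * norm (b (k - i)))) \<longlonglongrightarrow>
      (\<Sum>k. norm (a k)) * (\<Sum>k. norm (b k)) - (\<Sum>k. norm (a k)) * (\<Sum>k. norm (b k))"
    using Cauchy_product_sums[of "\<lambda>k. norm (a k)" "\<lambda>k. norm (b k)"] a b
    by (intro tendsto_diff tendsto_mult summable_LIMSEQ) (auto simp: sums_def)
  then have lim: "(\<lambda>N. K * (\<Sum>(i,j)\<in>S N. norm (a i) * norm (b j))) \<longlonglongrightarrow> K * 0"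
    using sum_square_diff_triangle[of "\<lambda>i j. norm (a i) * norm (b j)"]
    by (intro tendsto_mult_left) (simp add: sum_product S_def)
  have "norm (B (\<Sum>k<N. a k) (\<Sum>k<N. b k) - (\<Sum>k<N. \<Sum>i\<le>k. B (a i) (b (k - i))))
      \<le> K * (\<Sum>(i,j)\<in>S N. norm (a i) * norm (b j))" for N
  proof -
    have "B (\<Sum>k<N. a k) (\<Sum>k<N. b k) = (\<Sum>i<N. \<Sum>j<N. B (a i) (b j))"
      by (subst sum_left, intro sum.cong refl) (rule sum_right)
    then have "norm (B (\<Sum>k<N. a k) (\<Sum>k<N. b k) - (\<Sum>k<N. \<Sum>i\<le>k. B (a i) (b (k - i))))
        = norm (\<Sum>(i,j)\<in>S N. B (a i) (b j))"
      by (simp add: sum_square_diff_triangle[of "\<lambda>i j. B (a i) (b j)"] S_def)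
    also have "\<dots> \<le> (\<Sum>(i,j)\<in>S N. K * (norm (a i) * norm (b j)))"
      using K by (intro sum_norm_le) (auto simp: mult_ac)
    finally show ?thesis by (simp add: sum_distrib_left case_prod_unfold)
  qed
  then show ?thesis
    by (intro Lim_null_comparison[OF _ lim[simplified]]) auto
qed

lemma real_analytic_affine:
  assumes L: "bounded_linear L" and "real_analytic_map_on J f"
  shows "real_analytic_map_on J (\<lambda>t. c + L (f t))"
proof (rule real_analyticI)
  fix t0 assume "t0 \<in> J"
  with assms(2) obtain a r C where e: "power_expansion J f t0 a r C"
    by (rule real_analytic_imp_power_expansion)
  have "(\<lambda>n. (t - t0) ^ n *\<^sub>R ((if n = 0 then c else 0) + L (a n))) sums (c + L (f t))"
    if t: "t \<in> J" "\<bar>t - t0\<bar> < r" for t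
  proof -
    have "(\<lambda>n. if n = 0 then c else 0) sums c" using sums_single[of 0 "\<lambda>_. c"] by simp
    moreover have "(\<lambda>n. L ((t - t0) ^ n *\<^sub>R a n)) sums L (f t)"
      using e t by (intro bounded_linear.sums[OF L]) (auto simp: power_expansion_def)
    ultimately have "(\<lambda>n. (if n = 0 then c else 0) + L ((t - t0) ^ n *\<^sub>R a n)) sums (c + L (f t))"
      by (rule sums_add)
    moreover have "(if n = 0 then c else 0) + L ((t - t0) ^ n *\<^sub>R a n)
        = (t - t0) ^ n *\<^sub>R ((if n = 0 then c else 0) + L (a n))" for n
      using bounded_linear.linear[OF L] by (simp add: linear_cmul scaleR_add_right)
    ultimately show ?thesis by simp
  qed
  then show "\<exists>r>0. \<exists>a. \<forall>t\<in>J. \<bar>t - t0\<bar> < r \<longrightarrow> (\<lambda>n. (t - t0) ^ n *\<^sub>R a n) sums (c + L (f t))"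
    using e unfolding power_expansion_def
    by (intro exI[of _ r] conjI exI[of _ "\<lambda>n. (if n = 0 then c else 0) + L (a n)"]) auto
qed

lemma Cauchy_product_coeff:
  assumes "bounded_bilinear B"
  shows "(\<Sum>i\<le>k. B (s ^ i *\<^sub>R a i) (s ^ (k - i) *\<^sub>R b (k - i)))
    = s ^ k *\<^sub>R (\<Sum>i\<le>k. B (a i) (b (k - i)))"
proof -
  interpret bounded_bilinear B by fact
  have "B (s ^ i *\<^sub>R a i) (s ^ (k - i) *\<^sub>R b (k - i)) = s ^ k *\<^sub>R B (a i) (b (k - i))" if "i \<le> k" for i
  proof -
    have "s ^ k = s ^ (k - i) * s ^ i" using that by (simp flip: power_add)
    then show ?thesis by (simp add: scaleR_left scaleR_right)
  qed
  then show ?thesis by (simp add: scaleR_sum_right)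
qed

lemma real_analytic_bilinear:
  assumes B: "bounded_bilinear B"
    and f: "real_analytic_map_on J f" and g: "real_analytic_map_on J g"
  shows "real_analytic_map_on J (\<lambda>t. B (f t) (g t))"
proof (rule real_analyticI)
  fix t0 assume t0: "t0 \<in> J"
  from f t0 obtain a r1 C1 where a1: "power_expansion J f t0 a r1 C1"
    by (rule real_analytic_imp_power_expansion)
  from g t0 obtain b r2 C2 where b2: "power_expansion J g t0 b r2 C2"
    by (rule real_analytic_imp_power_expansion)
  define r where "r = min r1 r2"
  have r: "r > 0" using a1 b2 by (simp add: r_def power_expansion_def)
  have a: "power_expansion J f t0 a r C1" and b: "power_expansion J g t0 b r C2"
    using power_expansion_shrink[OF a1 r] power_expansion_shrink[OF b2 r] by (auto simp: r_def)
  have "(\<lambda>n. (t - t0) ^ n *\<^sub>R (\<Sum>i\<le>n. B (a i) (b (n - i)))) sums B (f t) (g t)"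
    if t: "t \<in> J" "\<bar>t - t0\<bar> < r" for t
  proof -
    let ?a = "\<lambda>n. (t - t0) ^ n *\<^sub>R a n" and ?b = "\<lambda>n. (t - t0) ^ n *\<^sub>R b n"
    have "?a sums f t" "?b sums g t" using a b t by (auto simp: power_expansion_def)
    then have "(\<lambda>N. B (\<Sum>k<N. ?a k) (\<Sum>k<N. ?b k)) \<longlonglongrightarrow> B (f t) (g t)"
      unfolding sums_def by (rule bounded_bilinear.tendsto[OF B])
    moreover have "(\<lambda>N. B (\<Sum>k<N. ?a k) (\<Sum>k<N. ?b k) - (\<Sum>k<N. \<Sum>i\<le>k. B (?a i) (?b (k - i)))) \<longlonglongrightarrow> 0"
      using a b t r unfolding power_expansion_def
      by (intro Cauchy_product_bilinear[OF B]; intro power_expansion_summable_norm) blast+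
    ultimately have "(\<lambda>N. \<Sum>k<N. \<Sum>i\<le>k. B (?a i) (?b (k - i))) \<longlonglongrightarrow> B (f t) (g t) - 0"
      using tendsto_diff by fastforce
    then show ?thesis unfolding sums_def Cauchy_product_coeff[OF B] by simp
  qed
  then show "\<exists>r>0. \<exists>a. \<forall>t\<in>J. \<bar>t - t0\<bar> < r \<longrightarrow> (\<lambda>n. (t - t0) ^ n *\<^sub>R a n) sums B (f t) (g t)"
    using r by (intro exI[of _ r] conjI exI[of _ "\<lambda>n. \<Sum>i\<le>n. B (a i) (b (n - i))"]) auto
qed

text \<open>
  The coefficients of the formal power series inverse to the one with coefficients \<open>a\<close>, where \<open>g\<close>
  inverts the constant term.
\<close>

fun reciprocal_coeff ::
    "(nat \<Rightarrow> 'b::real_normed_vector \<Rightarrow>\<^sub>L 'b) \<Rightarrow> ('b \<Rightarrow>\<^sub>L 'b) \<Rightarrow> nat \<Rightarrow> 'b \<Rightarrow>\<^sub>L 'b" where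
  "reciprocal_coeff a g 0 = g"
| "reciprocal_coeff a g (Suc n) = - (g o\<^sub>L (\<Sum>i\<le>n. a (Suc i) o\<^sub>L reciprocal_coeff a g (n - i)))"

lemma reciprocal_coeff_convolution:
  assumes "a 0 o\<^sub>L g = id_blinfun"
  shows "(\<Sum>i\<le>n. a i o\<^sub>L reciprocal_coeff a g (n - i)) = (if n = 0 then id_blinfun else 0)"
proof (cases n)
  case 0
  then show ?thesis using assms by simp
next
  case (Suc m)
  have ag: "a 0 (g x) = x" for x
    using assms by (metis blinfun_apply_blinfun_compose blinfun_apply_id_blinfun)
  show ?thesis unfolding Suc
    by (rule blinfun_eqI)
      (simp add: sum.atMost_Suc_shift blinfun.bilinear_simps ag del: sum.atMost_Suc)
qed

text \<open>
  The radius is shrunk until \<open>norm g\<close> times the sum of the \<open>norm (a k) * \<rho> ^ k\<close> over \<open>k \<ge> 1\<close> is at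
  most 1. The recursion for the coefficients then reproduces the bound \<open>norm g\<close>.
\<close>

lemma reciprocal_coeff_bound:
  assumes a: "\<And>n. norm (a n) * r ^ n \<le> C" and r: "0 < r"
    and \<rho>: "\<rho> = r / (2 * (1 + norm g * C))"
  shows "norm (reciprocal_coeff a g n) * \<rho> ^ n \<le> norm g"
proof -
  have C: "C \<ge> 0" using order_trans[OF norm_ge_zero a[of 0, simplified]] .
  define q where "q = \<rho> / r"
  have D: "1 + norm g * C > 0" using C by (simp add: add_pos_nonneg)
  have q_eq: "q = 1 / (2 * (1 + norm g * C))" using r by (simp add: q_def \<rho>)
  have q: "0 < q" "q \<le> 1 / 2" and qC: "norm g * C * (2 * q) \<le> 1"
    unfolding q_eq using C D by (auto simp: field_simps)
  have \<rho>0: "\<rho> > 0" using r D by (simp add: \<rho>)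
  \<comment> \<open>the factor 2 in the radius gives \<open>q \<le> 1 / 2\<close>, so the geometric sum costs at most a factor 2\<close>
  have geo: "(\<Sum>i\<le>m. q ^ Suc i) \<le> 2 * q" for m
  proof -
    have "(\<Sum>i\<le>m. q ^ Suc i) \<le> 2 * q * (1 - q ^ Suc m)"
    proof (induction m)
      case 0
      have "2 * (q * q) \<le> q" using mult_left_mono[OF q(2), of q] q by simp
      then show ?case by (simp add: algebra_simps)
    next
      case (Suc m)
      have "2 * q * q ^ Suc (Suc m) \<le> q ^ Suc (Suc m)"
        using q by (intro mult_left_le_one_le) auto
      then show ?case using Suc by (simp add: algebra_simps)
    qed
    also have "\<dots> \<le> 2 * q" using q by (simp add: algebra_simps)
    finally show ?thesis .
  qed
  show ?thesis
  proof (induction n rule: less_induct)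
    case (less n)
    show ?case
    proof (cases n)
      case 0
      then show ?thesis by simp
    next
      case (Suc m)
      let ?b = "reciprocal_coeff a g"
      have term_le: "norm (a (Suc i) o\<^sub>L ?b (m - i)) * \<rho> ^ Suc m \<le> C * q ^ Suc i * norm g"
        if i: "i \<le> m" for i
      proof -
        have "norm (a (Suc i)) * \<rho> ^ Suc i = norm (a (Suc i)) * r ^ Suc i * q ^ Suc i"
          using r by (simp add: q_def power_divide)
        also have "\<dots> \<le> C * q ^ Suc i" using q by (intro mult_right_mono a) auto
        finally have 1: "norm (a (Suc i)) * \<rho> ^ Suc i \<le> C * q ^ Suc i" .
        have 2: "norm (?b (m - i)) * \<rho> ^ (m - i) \<le> norm g"
          using less[of "m - i"] Suc by simp
        have "\<rho> ^ Suc m = \<rho> ^ Suc i * \<rho> ^ (m - i)"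
          using i by (simp flip: power_add)
        then have "norm (a (Suc i) o\<^sub>L ?b (m - i)) * \<rho> ^ Suc m
            \<le> (norm (a (Suc i)) * norm (?b (m - i))) * (\<rho> ^ Suc i * \<rho> ^ (m - i))"
          using \<rho>0 norm_blinfun_compose by (metis mult_right_mono less_imp_le zero_less_power)
        also have "\<dots> = (norm (a (Suc i)) * \<rho> ^ Suc i) * (norm (?b (m - i)) * \<rho> ^ (m - i))"
          by (simp only: mult_ac)
        also have "\<dots> \<le> (C * q ^ Suc i) * norm g"
          using \<rho>0 C q by (intro mult_mono[OF 1 2]) auto
        finally show ?thesis .
      qed
      have "norm (?b n) * \<rho> ^ n
          \<le> norm g * norm (\<Sum>i\<le>m. a (Suc i) o\<^sub>L ?b (m - i)) * \<rho> ^ Suc m"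
        unfolding Suc using \<rho>0 norm_blinfun_compose[of g] by (auto intro!: mult_right_mono)
      also have "\<dots> \<le> norm g * (\<Sum>i\<le>m. norm (a (Suc i) o\<^sub>L ?b (m - i))) * \<rho> ^ Suc m"
        using \<rho>0 by (intro mult_right_mono mult_left_mono norm_sum) auto
      also have "\<dots> = norm g * (\<Sum>i\<le>m. norm (a (Suc i) o\<^sub>L ?b (m - i)) * \<rho> ^ Suc m)"
        by (simp only: sum_distrib_right mult.assoc)
      also have "\<dots> \<le> norm g * (\<Sum>i\<le>m. C * q ^ Suc i * norm g)"
        using term_le by (intro mult_left_mono sum_mono) auto
      also have "\<dots> = norm g * (norm g * C * (\<Sum>i\<le>m. q ^ Suc i))"
        by (simp add: sum_distrib_left sum_distrib_right mult_ac)
      also have "\<dots> \<le> norm g * (norm g * C * (2 * q))"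
        using geo C by (intro mult_left_mono) auto
      also have "\<dots> \<le> norm g" using mult_left_mono[OF qC norm_ge_zero[of g]] by simp
      finally show ?thesis .
    qed
  qed
qed

text \<open>
  If \<open>A\<close> and \<open>B\<close> are the partial sums of the series of \<open>f\<close> and of the formal reciprocal, then \<open>A B\<close>
  tends to the identity by the comparison with the Cauchy product, and so does \<open>f t B\<close>, because
  \<open>B\<close> stays bounded. Multiplying by the given inverse \<open>g t\<close> shows that \<open>B\<close> converges to it.
\<close>

lemma real_analytic_inverse:
  fixes f g :: "real \<Rightarrow> 'b::real_normed_vector \<Rightarrow>\<^sub>L 'b"
  assumes f: "real_analytic_map_on J f"
    and gf: "\<And>s. s \<in> J \<Longrightarrow> g s o\<^sub>L f s = id_blinfun"
    and fg: "\<And>s. s \<in> J \<Longrightarrow> f s o\<^sub>L g s = id_blinfun"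
  shows "real_analytic_map_on J g"
proof (rule real_analyticI)
  fix t0 assume t0: "t0 \<in> J"
  from f t0 obtain a r C where a: "power_expansion J f t0 a r C"
    by (rule real_analytic_imp_power_expansion)
  then have r: "r > 0" and bd: "\<And>n. norm (a n) * r ^ n \<le> C" by (auto simp: power_expansion_def)
  have C: "C \<ge> 0" using order_trans[OF norm_ge_zero bd[of 0, simplified]] .
  define b where "b = reciprocal_coeff a (g t0)"
  define \<rho> where "\<rho> = r / (2 * (1 + norm (g t0) * C))"
  have "norm (g t0) * C \<ge> 0" using C by simp
  then have \<rho>: "0 < \<rho>" "\<rho> \<le> r" using r unfolding \<rho>_def by (auto simp: divide_le_eq)
  have b_bd: "norm (b n) * \<rho> ^ n \<le> norm (g t0)" for n
    unfolding b_def using reciprocal_coeff_bound[OF bd r \<rho>_def] .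
  have conv: "(\<Sum>i\<le>n. a i o\<^sub>L b (n - i)) = (if n = 0 then id_blinfun else 0)" for n
    unfolding b_def
    by (rule reciprocal_coeff_convolution) (use power_expansion_0[OF a t0] fg[OF t0] in simp)
  have "(\<lambda>n. (t - t0) ^ n *\<^sub>R b n) sums g t" if t: "t \<in> J" "\<bar>t - t0\<bar> < \<rho>" for t
  proof -
    let ?a = "\<lambda>n. (t - t0) ^ n *\<^sub>R a n" and ?b = "\<lambda>n. (t - t0) ^ n *\<^sub>R b n"
    let ?A = "\<lambda>N. \<Sum>k<N. ?a k" and ?B = "\<lambda>N. \<Sum>k<N. ?b k"
    have sb: "summable (\<lambda>n. norm (?b n))"
      by (rule power_expansion_summable_norm[OF b_bd \<rho>(1) t(2)])
    have sa: "summable (\<lambda>n. norm (?a n))"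
      by (rule power_expansion_summable_norm[OF bd r]) (use t \<rho> in auto)
    have "norm (?B N) \<le> (\<Sum>n. norm (?b n))" for N
      by (rule order_trans[OF norm_sum sum_le_suminf[OF sb]]) auto
    then have bddB: "Bfun ?B sequentially"
      by (intro BfunI[of _ "\<Sum>n. norm (?b n)"] always_eventually allI)
    have "?A \<longlonglongrightarrow> f t"
      using a t \<rho> by (auto simp: power_expansion_def sums_def)
    then have "Zfun (\<lambda>N. f t - ?A N) sequentially"
      using tendsto_Zfun_iff Zfun_minus[of "\<lambda>N. ?A N - f t"] by fastforce
    then have 1: "(\<lambda>N. (f t - ?A N) o\<^sub>L ?B N) \<longlonglongrightarrow> 0"
      unfolding tendsto_Zfun_iff
      using bounded_bilinear.Zfun_prod_Bfun[OF bounded_bilinear_blinfun_compose _ bddB] by simp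
    have "(\<lambda>N. (?A N o\<^sub>L ?B N) - (\<Sum>k<N. \<Sum>i\<le>k. ?a i o\<^sub>L ?b (k - i))) \<longlonglongrightarrow> 0"
      by (rule Cauchy_product_bilinear[OF bounded_bilinear_blinfun_compose sa sb])
    moreover have "(\<lambda>N. \<Sum>k<N. \<Sum>i\<le>k. ?a i o\<^sub>L ?b (k - i)) \<longlonglongrightarrow> id_blinfun"
    proof -
      have "(\<lambda>k. (t - t0) ^ k *\<^sub>R (if k = 0 then (id_blinfun :: 'b \<Rightarrow>\<^sub>L 'b) else 0))
            = (\<lambda>k. if k = 0 then (id_blinfun :: 'b \<Rightarrow>\<^sub>L 'b) else 0)" by auto
      then have "(\<lambda>k. (t - t0) ^ k *\<^sub>R (if k = 0 then (id_blinfun :: 'b \<Rightarrow>\<^sub>L 'b) else 0)) sums id_blinfun"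
        using sums_single[of 0 "\<lambda>_. id_blinfun :: 'b \<Rightarrow>\<^sub>L 'b"] by simp
      then show ?thesis
        unfolding Cauchy_product_coeff[OF bounded_bilinear_blinfun_compose] conv sums_def .
    qed
    ultimately have "(\<lambda>N. ?A N o\<^sub>L ?B N) \<longlonglongrightarrow> 0 + id_blinfun"
      using tendsto_add by fastforce
    from tendsto_add[OF 1 this]
    have "(\<lambda>N. f t o\<^sub>L ?B N) \<longlonglongrightarrow> id_blinfun"
      by (simp add: bounded_bilinear.diff_left[OF bounded_bilinear_blinfun_compose])
    then have "(\<lambda>N. g t o\<^sub>L (f t o\<^sub>L ?B N)) \<longlonglongrightarrow> (g t o\<^sub>L id_blinfun)"
      by (intro tendsto_intros)
    moreover have "g t o\<^sub>L (f t o\<^sub>L X) = X" "g t o\<^sub>L id_blinfun = g t"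
      for X :: "'b \<Rightarrow>\<^sub>L 'b"
      using gf[OF t(1)]
      by (auto intro!: blinfun_eqI) (metis blinfun_apply_blinfun_compose blinfun_apply_id_blinfun)
    ultimately show ?thesis unfolding sums_def by simp
  qed
  then show "\<exists>r>0. \<exists>a. \<forall>t\<in>J. \<bar>t - t0\<bar> < r \<longrightarrow> (\<lambda>n. (t - t0) ^ n *\<^sub>R a n) sums g t"
    using \<rho>(1) by (intro exI[of _ \<rho>] conjI exI[of _ b]) auto
qed

section \<open>Calculus of maps of any smoothness class\<close>

lemma C_on_affine:
  assumes "bounded_linear L" "C_on k J f"
  shows "C_on k J (\<lambda>t. c + L (f t))"
  using assms by (cases k) (auto intro: Cn_on_affine real_analytic_affine)

lemma C_on_bilinear:
  assumes "bounded_bilinear B" "C_on k J f" "C_on k J g"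
  shows "C_on k J (\<lambda>t. B (f t) (g t))"
  using assms by (cases k) (auto intro: Cn_on_bilinear real_analytic_bilinear)

lemma C_on_inverse:
  fixes f g :: "real \<Rightarrow> 'b::real_normed_vector \<Rightarrow>\<^sub>L 'b"
  assumes "C_on k J f"
    and "\<And>s. s \<in> J \<Longrightarrow> g s o\<^sub>L f s = id_blinfun"
    and "\<And>s. s \<in> J \<Longrightarrow> f s o\<^sub>L g s = id_blinfun"
  shows "C_on k J g"
  using assms by (cases k) (auto intro: Cn_on_inverse real_analytic_inverse)

lemma C_on_subset:
  assumes "C_on k J f" "I \<subseteq> J"
  shows "C_on k I f"
proof (cases k)
  case Omega
  show ?thesis unfolding Omega C_on.simps
  proof (rule real_analyticI)
    fix t0 assume "t0 \<in> I"
    then have "real_analytic_map_on J f" "t0 \<in> J" using assms Omega by auto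
    then obtain a r C where "power_expansion J f t0 a r C"
      by (rule real_analytic_imp_power_expansion)
    then show "\<exists>r>0. \<exists>a. \<forall>t\<in>I. \<bar>t - t0\<bar> < r \<longrightarrow> (\<lambda>n. (t - t0) ^ n *\<^sub>R a n) sums f t"
      using assms(2) unfolding power_expansion_def
      by (intro exI[of _ r] conjI exI[of _ a]) auto
  qed
qed (use assms in \<open>auto intro: Cn_on_subset\<close>)

lemma C_on_cong:
  assumes "\<And>t. t \<in> J \<Longrightarrow> f t = g t"
  shows "C_on k J f \<longleftrightarrow> C_on k J g"
  using assms Cn_on_cong[of J f g] by (cases k) (auto simp: real_analytic_map_on_def)

lemma C_on_imp_tendsto:
  assumes "C_on k J f" "t0 \<in> J"
  shows "(f \<longlongrightarrow> f t0) (at t0 within J)"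
proof (cases k)
  case Omega
  then show ?thesis
    using assms real_analytic_imp_power_expansion power_expansion_imp_tendsto
    by (metis C_on.simps(3))
next
  case (Fin n)
  then show ?thesis
    using assms Cn_on_imp_continuous_on[of n J f] by (auto simp: continuous_on_def)
next
  case Infinity
  then show ?thesis
    using assms Cn_on_imp_continuous_on[of 0 J f] by (auto simp: continuous_on_def)
qed

lemma C_on_imp_eventually_close:
  assumes "C_on k J f" "t0 \<in> J" "\<delta> > 0"
  obtains e where "e > 0" "\<And>t. t \<in> J \<inter> {t0 - e<..<t0 + e} \<Longrightarrow> norm (f t0 - f t) < \<delta>"
proof -
  have "eventually (\<lambda>t. dist (f t) (f t0) < \<delta>) (at t0 within J)"
    using C_on_imp_tendsto[OF assms(1,2)] assms(3) by (rule tendstoD)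
  then obtain e where e: "e > 0" "\<And>t. t \<in> J \<Longrightarrow> t \<noteq> t0 \<Longrightarrow> dist t t0 < e \<Longrightarrow> dist (f t) (f t0) < \<delta>"
    unfolding eventually_at by auto
  show thesis
  proof (rule that[OF e(1)])
    fix t assume "t \<in> J \<inter> {t0 - e<..<t0 + e}"
    then show "norm (f t0 - f t) < \<delta>"
      using e(2)[of t] assms(3)
      by (cases "t = t0") (auto simp: dist_real_def abs_less_iff dist_norm norm_minus_commute)
  qed
qed

lemma C_on_glue:
  assumes "is_interval J"
    and loc: "\<And>t0. t0 \<in> J \<Longrightarrow> \<exists>e>0. C_on k (J \<inter> {t0 - e<..<t0 + e}) f"
  shows "C_on k J f"
proof (cases k)
  case Omega
  show ?thesis unfolding Omega C_on.simps
  proof (rule real_analyticI)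
    fix t0 assume t0: "t0 \<in> J"
    then obtain e where e: "e > 0" "real_analytic_map_on (J \<inter> {t0 - e<..<t0 + e}) f"
      using loc Omega by auto
    then have "t0 \<in> J \<inter> {t0 - e<..<t0 + e}" using t0 by simp
    with e(2) obtain r a C where pe: "power_expansion (J \<inter> {t0 - e<..<t0 + e}) f t0 a r C"
      using real_analytic_imp_power_expansion by blast
    show "\<exists>r>0. \<exists>a. \<forall>t\<in>J. \<bar>t - t0\<bar> < r \<longrightarrow> (\<lambda>n. (t - t0) ^ n *\<^sub>R a n) sums f t"
      using pe e(1) unfolding power_expansion_def
      by (intro exI[of _ "min r e"] conjI exI[of _ a]) (auto simp: abs_less_iff)
  qed
next
  case (Fin n)
  have "Cn_on n J f"
    by (rule Cn_on_glue[OF assms(1)]) (use loc Fin in auto)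
  then show ?thesis using Fin by simp
next
  case Infinity
  have "Cn_on n J f" for n
    by (rule Cn_on_glue[OF assms(1)]) (use loc Infinity in auto)
  then show ?thesis using Infinity by simp
qed

section \<open>Projections and adjoints in Hilbert space\<close>

text \<open>
  The points of \<open>V\<close> whose squared distance to \<open>x\<close> is at most \<open>1 / n\<close> above the infimum form
  decreasing closed sets, and by the parallelogram identity their diameters tend to zero; their
  common point is the nearest point. Moving it in a direction \<open>v\<close> of \<open>V\<close> cannot decrease the
  distance, which forces \<open>x - p\<close> to be orthogonal to \<open>v\<close>.
\<close>

lemma closed_subspace_projection:
  fixes V :: "'a::{real_inner,complete_space} set"
  assumes "closed_subspace V"
  obtains p where "p \<in> V" "x - p \<in> V\<^sup>\<bottom>"
proof -
  have sub: "subspace V" and cl: "closed V" using assms by (auto simp: closed_subspace_def)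
  define d where "d = (INF v\<in>V. (norm (x - v))\<^sup>2)"
  have V0: "V \<noteq> {}" using subspace_0[OF sub] by auto
  have bdd: "bdd_below ((\<lambda>v. (norm (x - v))\<^sup>2) ` V)" by (intro bdd_belowI[of _ 0]) auto
  have d_le: "d \<le> (norm (x - v))\<^sup>2" if "v \<in> V" for v
    unfolding d_def by (rule cINF_lower[OF bdd that])
  define S where "S n = {v \<in> V. (norm (x - v))\<^sup>2 \<le> d + 1 / real (Suc n)}" for n
  obtain p where p: "\<And>n. p \<in> S n"
  proof (rule decreasing_closed_nest[of S])
    show "closed (S n)" for n
    proof -
      have "S n = V \<inter> {v. (norm (x - v))\<^sup>2 \<le> d + 1 / real (Suc n)}" by (auto simp: S_def)
      then show ?thesis using cl by (simp only:) (intro closed_Int closed_Collect_le continuous_intros)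
    qed
    show "S n \<noteq> {}" for n
    proof -
      have "d < d + 1 / real (Suc n)" by simp
      then obtain v where "v \<in> V" "(norm (x - v))\<^sup>2 < d + 1 / real (Suc n)"
        unfolding d_def using cINF_less_iff[OF V0 bdd] by blast
      then show ?thesis by (auto simp: S_def intro!: exI[of _ v])
    qed
    show "S n \<subseteq> S m" if "m \<le> n" for m n
    proof -
      have "1 / real (Suc n) \<le> 1 / real (Suc m)" using that by (intro divide_left_mono) auto
      then show ?thesis by (auto simp: S_def)
    qed
    show "\<exists>n. \<forall>v\<in>S n. \<forall>w\<in>S n. dist v w < \<epsilon>" if "\<epsilon> > 0" for \<epsilon>
    proof -
      obtain n where n: "1 / real (Suc n) < \<epsilon>\<^sup>2 / 4"
        using reals_Archimedean[of "\<epsilon>\<^sup>2 / 4"] \<open>\<epsilon> > 0\<close> by (auto simp: inverse_eq_divide)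
      have "dist v w < \<epsilon>" if "v \<in> S n" "w \<in> S n" for v w
      proof -
        have v: "v \<in> V" "(norm (x - v))\<^sup>2 \<le> d + 1 / real (Suc n)"
          and w: "w \<in> V" "(norm (x - w))\<^sup>2 \<le> d + 1 / real (Suc n)" using that by (auto simp: S_def)
        have "(1 / 2) *\<^sub>R (v + w) \<in> V" using v w sub by (intro subspace_scale subspace_add)
        then have mid: "d \<le> (norm (x - (1 / 2) *\<^sub>R (v + w)))\<^sup>2" by (rule d_le)
        have "(norm (v - w))\<^sup>2 = 2 * (norm (x - v))\<^sup>2 + 2 * (norm (x - w))\<^sup>2
            - 4 * (norm (x - (1 / 2) *\<^sub>R (v + w)))\<^sup>2"
          by (simp add: power2_norm_eq_inner inner_diff_left inner_diff_right inner_add_left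
              inner_add_right inner_commute algebra_simps)
        also have "\<dots> < \<epsilon>\<^sup>2" using mid v(2) w(2) n by linarith
        finally show ?thesis using \<open>\<epsilon> > 0\<close> by (simp add: dist_norm power2_less_imp_less)
      qed
      then show ?thesis by blast
    qed
  qed (rule that)
  have pV: "p \<in> V" using p[of 0] by (simp add: S_def)
  have min: "(norm (x - p))\<^sup>2 \<le> (norm (x - v))\<^sup>2" if "v \<in> V" for v
  proof -
    have "(\<lambda>n. d + 1 / real (Suc n)) \<longlonglongrightarrow> d + 0"
      by (intro tendsto_intros LIMSEQ_inverse_real_of_nat[unfolded inverse_eq_divide])
    then have "(norm (x - p))\<^sup>2 \<le> d"
      using p by (intro LIMSEQ_le_const) (auto simp: S_def)
    then show ?thesis using d_le[OF that] by (rule order_trans)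
  qed
  have "v \<bullet> (x - p) = 0" if v: "v \<in> V" for v
  proof (cases "v = 0")
    case False
    \<comment> \<open>the step along \<open>v\<close> that minimises the distance to \<open>x\<close>\<close>
    define s where "s = (v \<bullet> (x - p)) / (v \<bullet> v)"
    have vv: "v \<bullet> v > 0" using False by simp
    have "p + s *\<^sub>R v \<in> V" using pV v sub by (intro subspace_add subspace_scale)
    then have "(norm (x - p))\<^sup>2 \<le> (norm (x - (p + s *\<^sub>R v)))\<^sup>2" by (rule min)
    also have "\<dots> = (norm (x - p))\<^sup>2 - 2 * s * (v \<bullet> (x - p)) + s\<^sup>2 * (v \<bullet> v)"
      by (simp add: power2_norm_eq_inner inner_diff_left inner_diff_right inner_add_left
          inner_add_right inner_commute algebra_simps power2_eq_square[of s])
    also have "\<dots> = (norm (x - p))\<^sup>2 - (v \<bullet> (x - p))\<^sup>2 / (v \<bullet> v)"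
      using vv by (simp add: s_def power2_eq_square field_simps)
    finally have "(v \<bullet> (x - p))\<^sup>2 / (v \<bullet> v) \<le> 0" by simp
    then show ?thesis using vv by (simp add: divide_le_0_iff)
  qed simp
  then have "x - p \<in> V\<^sup>\<bottom>" by (auto simp: orthogonal_comp_def orthogonal_def)
  with pV show thesis by (rule that)
qed

lemma orthogonal_decomposition_unique:
  assumes "subspace V" "p \<in> V" "x - p \<in> V\<^sup>\<bottom>" "q \<in> V" "x - q \<in> V\<^sup>\<bottom>"
  shows "p = q"
proof -
  have "p - q \<in> V" using assms by (intro subspace_diff)
  moreover have "(x - q) - (x - p) \<in> V\<^sup>\<bottom>"
    by (rule subspace_diff[OF subspace_orthogonal_comp assms(5,3)])
  ultimately have "(p - q) \<bullet> (p - q) = 0"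
    by (auto simp: orthogonal_comp_def orthogonal_def)
  then show ?thesis by simp
qed

lemma orth_proj_props:
  fixes V :: "'a::{real_inner,complete_space} set"
  assumes V: "closed_subspace V"
  shows orth_proj_in: "orth_proj V x \<in> V"
    and orth_proj_diff: "x - orth_proj V x \<in> V\<^sup>\<bottom>"
proof -
  have sub: "subspace V" using V by (simp add: closed_subspace_def)
  obtain P where P: "\<And>x. P x \<in> V" "\<And>x. x - P x \<in> V\<^sup>\<bottom>"
  proof -
    have "\<forall>x. \<exists>p. p \<in> V \<and> x - p \<in> V\<^sup>\<bottom>"
      using closed_subspace_projection[OF V] by blast
    then show thesis using that by metis
  qed
  have eqI: "P x = p" if "p \<in> V" "x - p \<in> V\<^sup>\<bottom>" for x p
    using orthogonal_decomposition_unique[OF sub P that] .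
  have "bounded_linear P"
  proof (rule bounded_linear_intro[of _ 1])
    show "P (x + y) = P x + P y" for x y
    proof (rule eqI)
      show "P x + P y \<in> V" using P sub by (intro subspace_add)
      have "(x - P x) + (y - P y) \<in> V\<^sup>\<bottom>" using P by (intro subspace_add subspace_orthogonal_comp)
      then show "x + y - (P x + P y) \<in> V\<^sup>\<bottom>" by (simp add: algebra_simps)
    qed
    show "P (r *\<^sub>R x) = r *\<^sub>R P x" for r x
    proof (rule eqI)
      show "r *\<^sub>R P x \<in> V" using P sub by (intro subspace_scale)
      have "r *\<^sub>R (x - P x) \<in> V\<^sup>\<bottom>" using P by (intro subspace_scale subspace_orthogonal_comp)
      then show "r *\<^sub>R x - r *\<^sub>R P x \<in> V\<^sup>\<bottom>" by (simp add: algebra_simps)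
    qed
    show "norm (P x) \<le> norm x * 1" for x
    proof -
      have "P x \<bullet> (x - P x) = 0" using P by (auto simp: orthogonal_comp_def orthogonal_def)
      then have "(norm (P x))\<^sup>2 = P x \<bullet> x" by (simp add: power2_norm_eq_inner inner_diff_right)
      also have "\<dots> \<le> norm (P x) * norm x" by (rule norm_cauchy_schwarz)
      finally show ?thesis
        by (cases "P x = 0") (auto simp: power2_eq_square)
    qed
  qed
  then have ap: "blinfun_apply (Blinfun P) = P" by (rule bounded_linear_Blinfun_apply)
  have "\<forall>x. orth_proj V x \<in> V \<and> x - orth_proj V x \<in> V\<^sup>\<bottom>"
    unfolding orth_proj_def
  proof (rule theI[of _ "Blinfun P"])
    show "\<forall>x. Blinfun P x \<in> V \<and> x - Blinfun P x \<in> V\<^sup>\<bottom>" using P by (simp add: ap)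
    show "Q = Blinfun P" if "\<forall>x. blinfun_apply Q x \<in> V \<and> x - blinfun_apply Q x \<in> V\<^sup>\<bottom>" for Q
      by (rule blinfun_eqI) (use eqI[symmetric] that in \<open>simp add: ap\<close>)
  qed
  then show "orth_proj V x \<in> V" "x - orth_proj V x \<in> V\<^sup>\<bottom>" by auto
qed

lemma orth_proj_eqI:
  fixes V :: "'a::{real_inner,complete_space} set"
  assumes "closed_subspace V" "p \<in> V" "x - p \<in> V\<^sup>\<bottom>"
  shows "orth_proj V x = p"
  using orthogonal_decomposition_unique[of V "orth_proj V x" x p] orth_proj_props[OF assms(1)] assms
  by (auto simp: closed_subspace_def)

lemma orth_proj_ident:
  fixes V :: "'a::{real_inner,complete_space} set"
  assumes "closed_subspace V" "x \<in> V"
  shows "orth_proj V x = x"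
  using assms by (intro orth_proj_eqI) (auto simp: subspace_0 subspace_orthogonal_comp)

lemma inner_orth_proj_commute:
  fixes V :: "'a::{real_inner,complete_space} set"
  assumes "closed_subspace V"
  shows "orth_proj V x \<bullet> y = x \<bullet> orth_proj V y"
proof -
  have "orth_proj V x \<bullet> (y - orth_proj V y) = 0" "orth_proj V y \<bullet> (x - orth_proj V x) = 0"
    using orth_proj_props[OF assms] by (auto simp: orthogonal_comp_def orthogonal_def)
  then show ?thesis by (simp add: inner_diff_right inner_commute)
qed

text \<open>
  A vector \<open>z\<close> orthogonal to the kernel of a nonzero functional exists by projection, and a multiple
  of it represents the functional, since the kernel has codimension one.
\<close>

lemma Riesz_representation:
  fixes \<phi> :: "'a::{real_inner,complete_space} \<Rightarrow> real"
  assumes "bounded_linear \<phi>"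
  obtains w where "\<And>x. \<phi> x = x \<bullet> w"
proof (cases "\<forall>x. \<phi> x = 0")
  case True
  then show thesis using that[of 0] by simp
next
  case False
  interpret bounded_linear \<phi> by fact
  obtain u where u: "\<phi> u \<noteq> 0" using False by blast
  let ?K = "{x. \<phi> x = 0}"
  have K: "closed_subspace ?K"
    unfolding closed_subspace_def
  proof
    show "subspace ?K" by (auto simp: subspace_def zero add scaleR)
    show "closed ?K" by (intro closed_Collect_eq linear_continuous_on assms continuous_on_const)
  qed
  define z where "z = u - orth_proj ?K u"
  have z: "z \<in> ?K\<^sup>\<bottom>" unfolding z_def by (rule orth_proj_diff[OF K])
  have \<phi>z: "\<phi> z \<noteq> 0" using orth_proj_in[OF K, of u] u by (simp add: z_def diff)
  then have zz: "z \<bullet> z \<noteq> 0" by (auto simp: zero)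
  show thesis
  proof (rule that)
    fix x
    have "x - (\<phi> x / \<phi> z) *\<^sub>R z \<in> ?K" using \<phi>z by (simp add: diff scaleR)
    then have "(x - (\<phi> x / \<phi> z) *\<^sub>R z) \<bullet> z = 0"
      using z by (auto simp: orthogonal_comp_def orthogonal_def)
    then have "x \<bullet> z = \<phi> x / \<phi> z * (z \<bullet> z)" by (simp add: inner_diff_left)
    then show "\<phi> x = x \<bullet> ((\<phi> z / (z \<bullet> z)) *\<^sub>R z)" using \<phi>z zz by simp
  qed
qed

text \<open>
  Taking adjoints is obtained as a bounded linear map on operators (the scalars are real), so that it
  preserves every smoothness class.
\<close>

lemma adjoint_blinfun_exists:
  obtains adj :: "('a::{real_inner,complete_space} \<Rightarrow>\<^sub>L 'a) \<Rightarrow> ('a \<Rightarrow>\<^sub>L 'a)"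
  where "bounded_linear adj" "\<And>T x y. adj T x \<bullet> y = x \<bullet> T y"
proof -
  have ex: "\<exists>w. \<forall>y. T y \<bullet> x = y \<bullet> w" for T :: "'a \<Rightarrow>\<^sub>L 'a" and x
  proof -
    have "bounded_linear (\<lambda>y. T y \<bullet> x)"
      by (intro bounded_linear_compose[OF bounded_linear_inner_left] blinfun.bounded_linear_right)
    then show ?thesis by (rule Riesz_representation) blast
  qed
  define a where "a T x = (SOME w. \<forall>y. blinfun_apply T y \<bullet> x = y \<bullet> w)" for T :: "'a \<Rightarrow>\<^sub>L 'a" and x
  have a: "T y \<bullet> x = y \<bullet> a T x" for T :: "'a \<Rightarrow>\<^sub>L 'a" and x y
    using someI_ex[OF ex[of T x]] unfolding a_def by blast
  have eqI: "u = v" if "\<And>y. y \<bullet> u = y \<bullet> v" for u v :: 'a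
    using that inner_eq_zero_iff[of "u - v"] by (simp add: inner_diff_right)
  have a_norm: "norm (a T x) \<le> norm T * norm x" for T :: "'a \<Rightarrow>\<^sub>L 'a" and x
  proof (cases "a T x = 0")
    case False
    have "norm (a T x) * norm (a T x) = T (a T x) \<bullet> x"
      by (simp add: a flip: power2_norm_eq_inner power2_eq_square)
    also have "\<dots> \<le> norm (T (a T x)) * norm x" by (rule norm_cauchy_schwarz)
    also have "\<dots> \<le> norm T * norm (a T x) * norm x"
      by (intro mult_right_mono norm_blinfun) auto
    finally show ?thesis using False by (simp add: mult_ac)
  qed simp
  have a_lin: "bounded_linear (a T)" for T
  proof (rule bounded_linear_intro[of _ "norm T"])
    show "a T (x + y) = a T x + a T y" for x y
      by (rule eqI) (simp add: inner_add_right flip: a)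
    show "a T (r *\<^sub>R x) = r *\<^sub>R a T x" for r x
      by (rule eqI) (simp flip: a)
  qed (use a_norm in \<open>simp add: mult.commute\<close>)
  define adj where "adj T = Blinfun (a T)" for T
  have adj: "blinfun_apply (adj T) = a T" for T
    unfolding adj_def by (rule bounded_linear_Blinfun_apply[OF a_lin])
  show thesis
  proof (rule that)
    show "adj T x \<bullet> y = x \<bullet> T y" for T x y
      using a[of T y x] by (simp add: adj inner_commute)
    show "bounded_linear adj"
    proof (rule bounded_linear_intro[of _ 1])
      show "adj (S + T) = adj S + adj T" for S T
        by (intro blinfun_eqI eqI)
          (simp add: adj blinfun.add_left inner_add_right inner_add_left flip: a)
      show "adj (r *\<^sub>R T) = r *\<^sub>R adj T" for r T
        by (intro blinfun_eqI eqI) (simp add: adj blinfun.scaleR_left flip: a)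
      show "norm (adj T) \<le> norm T * 1" for T
        by (rule norm_blinfun_bound) (auto simp: adj a_norm)
    qed
  qed
qed

section \<open>The two implications\<close>

text \<open>
  Solving \<open>W x = y\<close> means finding a fixed point of \<open>x \<mapsto> x - W x + y\<close>, a contraction with constant
  \<open>norm (id_blinfun - W)\<close>. The same constant bounds \<open>W\<close> from below, which gives injectivity and a
  bound for the inverse.
\<close>

lemma GL_near_identity:
  fixes W :: "'a::{real_normed_vector,complete_space} \<Rightarrow>\<^sub>L 'a"
  assumes "norm (id_blinfun - W) < 1"
  shows "W \<in> GL"
proof -
  define c where "c = norm (id_blinfun - W)"
  have c: "0 \<le> c" "c < 1" using assms by (auto simp: c_def)
  have lb: "(1 - c) * norm x \<le> norm (W x)" for x
  proof -
    have "norm (x - W x) \<le> c * norm x"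
      using norm_blinfun[of "id_blinfun - W" x] by (simp add: c_def blinfun.diff_left)
    then show ?thesis using norm_triangle_ineq2[of x "W x"] by (simp add: algebra_simps)
  qed
  have "\<exists>x. W x = y" for y
  proof -
    have "\<exists>!x. x - W x + y = x"
    proof (rule banach_fix_type[OF c], intro allI)
      fix u v
      have "dist (u - W u + y) (v - W v + y) = norm ((id_blinfun - W) (u - v))"
        by (simp add: dist_norm blinfun.diff_left blinfun.diff_right algebra_simps)
      also have "\<dots> \<le> c * norm (u - v)" unfolding c_def by (rule norm_blinfun)
      finally show "dist (u - W u + y) (v - W v + y) \<le> c * dist u v" by (simp add: dist_norm)
    qed
    then obtain x where "x - W x + y = x" by blast
    then have "W x = y" by (simp add: algebra_simps)
    then show ?thesis ..
  qed
  then obtain S where S: "\<And>y. W (S y) = y" by metis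
  have inj: "u = v" if "W u = W v" for u v
  proof -
    have "W (u - v) = 0" using that by (simp add: blinfun.diff_right)
    then have "(1 - c) * norm (u - v) \<le> 0" using lb[of "u - v"] by simp
    then show ?thesis using c by (simp add: mult_le_0_iff)
  qed
  have "bounded_linear S"
  proof (rule bounded_linear_intro[of _ "1 / (1 - c)"])
    show "S (x + y) = S x + S y" for x y by (rule inj) (simp add: S blinfun.add_right)
    show "S (r *\<^sub>R x) = r *\<^sub>R S x" for r x by (rule inj) (simp add: S blinfun.scaleR_right)
    show "norm (S x) \<le> norm x * (1 / (1 - c))" for x
      using lb[of "S x"] c by (simp add: S field_simps)
  qed
  then have "blinfun_apply (Blinfun S) = S" by (rule bounded_linear_Blinfun_apply)
  moreover have "S (W x) = x" for x by (rule inj) (rule S)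
  ultimately have "Blinfun S o\<^sub>L W = id_blinfun" "W o\<^sub>L Blinfun S = id_blinfun"
    by (auto intro!: blinfun_eqI simp: S)
  then show ?thesis unfolding GL_def by blast
qed

text \<open>
  With \<open>P0\<close> the projection at \<open>t0\<close>, the operator
  \<open>\<Psi> t = P0 P_t + (1 - P0) (1 - P_t)\<close> is an affine function of \<open>P_t\<close> and equals the identity at \<open>t0\<close>,
  so it is as smooth as \<open>P_t\<close> and invertible near \<open>t0\<close>. It maps \<open>V t\<close> into \<open>V t0\<close> and the
  complement of \<open>V t\<close> into that of \<open>V t0\<close>; being surjective, it maps \<open>V t\<close> onto \<open>V t0\<close>.
\<close>

lemma orth_proj_C_on_imp_family:
  fixes V :: "real \<Rightarrow> 'a::{real_inner,complete_space} set"
  assumes V: "\<And>t. t \<in> J \<Longrightarrow> closed_subspace (V t)"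
    and P: "C_on k J (\<lambda>t. orth_proj (V t))"
  shows "C_family_closed_subspaces k J V"
  unfolding C_family_closed_subspaces_def
proof (intro conjI ballI)
  fix t0 assume t0: "t0 \<in> J"
  define P0 where "P0 = orth_proj (V t0)"
  \<comment> \<open>the linear part of \<open>\<Psi>\<close> as a function of the projection; the constant part is \<open>1 - P0\<close>\<close>
  define L where "L X = (P0 o\<^sub>L X) - ((id_blinfun - P0) o\<^sub>L X)" for X :: "'a \<Rightarrow>\<^sub>L 'a"
  have L: "bounded_linear L"
    unfolding L_def
    by (intro bounded_linear_sub
        bounded_bilinear.bounded_linear_right[OF bounded_bilinear_blinfun_compose])
  define \<Psi> where "\<Psi> t = (id_blinfun - P0) + L (orth_proj (V t))" for t
  have \<Psi>_apply: "\<Psi> t x = P0 (orth_proj (V t) x)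
      + ((x - orth_proj (V t) x) - P0 (x - orth_proj (V t) x))" for t x
    by (simp add: \<Psi>_def L_def blinfun.bilinear_simps)
  have P0P0: "P0 (P0 x) = P0 x" for x
    unfolding P0_def by (rule orth_proj_ident[OF V[OF t0] orth_proj_in[OF V[OF t0]]])
  have \<Psi>t0: "\<Psi> t0 = id_blinfun"
    by (rule blinfun_eqI) (simp add: \<Psi>_apply P0P0 blinfun.diff_right flip: P0_def)
  have C: "C_on k J \<Psi>" unfolding \<Psi>_def by (rule C_on_affine[OF L P])
  obtain e where e: "e > 0"
    and close: "\<And>t. t \<in> J \<inter> {t0 - e<..<t0 + e} \<Longrightarrow> norm (\<Psi> t0 - \<Psi> t) < 1"
    using C_on_imp_eventually_close[OF C t0, of 1] by auto
  have GL: "\<Psi> t \<in> GL" if "t \<in> J \<inter> {t0 - e<..<t0 + e}" for t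
    using close[OF that] unfolding \<Psi>t0 by (rule GL_near_identity)
  have image: "blinfun_apply (\<Psi> t) ` V t = V t0" if t: "t \<in> J \<inter> {t0 - e<..<t0 + e}" for t
  proof -
    have Vt: "closed_subspace (V t)" using t V by blast
    have on_V: "\<Psi> t v = P0 v" if "v \<in> V t" for v
      by (simp add: \<Psi>_apply orth_proj_ident[OF Vt that])
    have P0_in: "P0 x \<in> V t0" for x unfolding P0_def by (rule orth_proj_in[OF V[OF t0]])
    obtain S where S: "\<Psi> t o\<^sub>L S = id_blinfun" using GL[OF t] unfolding GL_def by blast
    have "y \<in> blinfun_apply (\<Psi> t) ` V t" if y: "y \<in> V t0" for y
    proof -
      define x where "x = S y"
      let ?v = "orth_proj (V t) x"
      have "\<Psi> t x = y"
        using S unfolding x_def by (metis blinfun_apply_blinfun_compose blinfun_apply_id_blinfun)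
      then have "P0 (\<Psi> t x) = y"
        using orth_proj_ident[OF V[OF t0] y] by (simp add: P0_def)
      then have "P0 ?v = y" by (simp add: \<Psi>_apply blinfun.bilinear_simps P0P0)
      then show ?thesis using on_V[OF orth_proj_in[OF Vt]] orth_proj_in[OF Vt] by (metis imageI)
    qed
    then show ?thesis using on_V P0_in by auto
  qed
  show "\<exists>\<epsilon>>0. \<exists>\<Psi> Vstar. (\<forall>t\<in>J \<inter> {t0 - \<epsilon><..<t0 + \<epsilon>}. \<Psi> t \<in> GL) \<and>
      C_on k (J \<inter> {t0 - \<epsilon><..<t0 + \<epsilon>}) \<Psi> \<and> closed_subspace Vstar \<and>
      (\<forall>t\<in>J \<inter> {t0 - \<epsilon><..<t0 + \<epsilon>}. blinfun_apply (\<Psi> t) ` V t = Vstar)"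
    using e GL image V[OF t0] C_on_subset[OF C, of "J \<inter> {t0 - e<..<t0 + e}"]
    by (intro exI[of _ e] conjI exI[of _ \<Psi>] exI[of _ "V t0"]) auto
qed (use V in auto)

text \<open>
  An idempotent \<open>Q\<close> with range \<open>V\<close> determines the orthogonal projection \<open>P\<close> onto \<open>V\<close> algebraically.
  As \<open>Q\<close> maps into \<open>V\<close>, \<open>P Q = Q\<close>; as \<open>Q\<close> fixes \<open>V\<close>, \<open>Q P = P\<close>, whose adjoint is \<open>P Q' = P\<close>. Hence
  \<open>P (1 + Q - Q') = Q\<close>, the formula of Kerzman and Stein.
\<close>

lemma orth_proj_from_idempotent:
  fixes V :: "'a::{real_inner,complete_space} set" and Q Q' :: "'a \<Rightarrow>\<^sub>L 'a"
  assumes V: "closed_subspace V"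
    and ran: "\<And>x. Q x \<in> V" and fix_V: "\<And>x. x \<in> V \<Longrightarrow> Q x = x"
    and adj: "\<And>x y. Q' x \<bullet> y = x \<bullet> Q y"
    and Z: "(id_blinfun + (Q - Q')) o\<^sub>L Z = id_blinfun"
  shows "orth_proj V = Q o\<^sub>L Z"
proof (rule blinfun_eqI)
  let ?P = "orth_proj V"
  have PQ: "?P (Q x) = Q x" for x using orth_proj_ident[OF V ran] .
  have PQ': "?P (Q' x) = ?P x" for x
  proof -
    have "?P (Q' x) \<bullet> y = ?P x \<bullet> y" for y
    proof -
      have "?P (Q' x) \<bullet> y = x \<bullet> Q (?P y)"
        by (simp add: inner_orth_proj_commute[OF V] adj)
      also have "\<dots> = ?P x \<bullet> y"
        by (simp add: fix_V[OF orth_proj_in[OF V]] inner_orth_proj_commute[OF V])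
      finally show ?thesis .
    qed
    then have "(?P (Q' x) - ?P x) \<bullet> (?P (Q' x) - ?P x) = 0" by (simp add: inner_diff_left)
    then show ?thesis by simp
  qed
  fix x
  have "?P ((id_blinfun + (Q - Q')) (Z x)) = Q (Z x)"
    by (simp add: blinfun.bilinear_simps PQ PQ')
  moreover have "(id_blinfun + (Q - Q')) (Z x) = x"
    using Z by (metis blinfun_apply_blinfun_compose blinfun_apply_id_blinfun)
  ultimately show "?P x = (Q o\<^sub>L Z) x" by simp
qed

text \<open>
  Transporting the projection at \<open>t0\<close> by the given automorphisms yields idempotents \<open>Q t\<close> onto \<open>V t\<close>
  that are as smooth as the automorphisms. At \<open>t0\<close> the idempotent is the orthogonal projection
  itself and thus self-adjoint, so \<open>W t = 1 + Q t - adj (Q t)\<close> is the identity there and invertible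
  nearby. The formula \<open>P = Q W\<^sup>-\<^sup>1\<close> gives smoothness near \<open>t0\<close>.
\<close>

lemma family_imp_orth_proj_C_on:
  fixes V :: "real \<Rightarrow> 'a::{real_inner,complete_space} set"
  assumes J: "is_interval J" and F: "C_family_closed_subspaces k J V"
  shows "C_on k J (\<lambda>t. orth_proj (V t))"
proof (rule C_on_glue[OF J])
  fix t0 assume t0: "t0 \<in> J"
  have V: "closed_subspace (V t)" if "t \<in> J" for t
    using F that by (simp add: C_family_closed_subspaces_def)
  obtain e \<Psi> Vstar where e: "e > 0"
    and GL: "\<And>t. t \<in> J \<inter> {t0 - e<..<t0 + e} \<Longrightarrow> \<Psi> t \<in> GL"
    and C: "C_on k (J \<inter> {t0 - e<..<t0 + e}) \<Psi>"
    and im: "\<And>t. t \<in> J \<inter> {t0 - e<..<t0 + e} \<Longrightarrow> blinfun_apply (\<Psi> t) ` V t = Vstar"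
    using F t0 unfolding C_family_closed_subspaces_def by meson
  define I where "I = J \<inter> {t0 - e<..<t0 + e}"
  have t0I: "t0 \<in> I" using t0 e by (simp add: I_def)
  have "\<forall>t\<in>I. \<exists>S. S o\<^sub>L \<Psi> t = id_blinfun \<and> \<Psi> t o\<^sub>L S = id_blinfun"
    using GL unfolding I_def GL_def by blast
  then obtain \<Phi> where \<Phi>: "\<And>t. t \<in> I \<Longrightarrow> \<Phi> t o\<^sub>L \<Psi> t = id_blinfun"
      "\<And>t. t \<in> I \<Longrightarrow> \<Psi> t o\<^sub>L \<Phi> t = id_blinfun"
    using bchoice by metis
  have inv: "\<Phi> t (\<Psi> t x) = x" "\<Psi> t (\<Phi> t x) = x" if "t \<in> I" for t x
    using \<Phi>[OF that] by (metis blinfun_apply_blinfun_compose blinfun_apply_id_blinfun)+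
  have C\<Psi>: "C_on k I \<Psi>" using C by (simp add: I_def)
  have C\<Phi>: "C_on k I \<Phi>" using C_on_inverse[OF C\<Psi> \<Phi>] .
  \<comment> \<open>an idempotent with range \<open>Vstar\<close>, independent of \<open>t\<close>\<close>
  define R where "R = \<Psi> t0 o\<^sub>L orth_proj (V t0) o\<^sub>L \<Phi> t0"
  define Q where "Q t = \<Phi> t o\<^sub>L (R o\<^sub>L \<Psi> t)" for t
  have CQ: "C_on k I Q"
  proof -
    have "C_on k I (\<lambda>t. 0 + (R o\<^sub>L \<Psi> t))"
      using C_on_affine[OF bounded_bilinear.bounded_linear_right[OF bounded_bilinear_blinfun_compose] C\<Psi>] .
    then show ?thesis
      unfolding Q_def using C_on_bilinear[OF bounded_bilinear_blinfun_compose C\<Phi>] by simp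
  qed
  have R_in: "R x \<in> Vstar" for x
    using im[of t0] t0I orth_proj_in[OF V[OF t0]] by (auto simp: R_def I_def)
  have R_fix: "R x = x" if x: "x \<in> Vstar" for x
  proof -
    obtain v where "v \<in> V t0" "x = \<Psi> t0 v" using im[of t0] t0I x by (auto simp: I_def)
    then show ?thesis
      using inv[OF t0I] orth_proj_ident[OF V[OF t0]] by (simp add: R_def)
  qed
  have Q_in: "Q t x \<in> V t" if t: "t \<in> I" for t x
  proof -
    obtain v where "v \<in> V t" "R (\<Psi> t x) = \<Psi> t v"
      using im[of t] t R_in[of "\<Psi> t x"] by (auto simp: I_def)
    then show ?thesis using inv[OF t] by (simp add: Q_def)
  qed
  have Q_fix: "Q t x = x" if t: "t \<in> I" and x: "x \<in> V t" for t x
  proof -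
    have "\<Psi> t x \<in> Vstar" using im[of t] t x by (auto simp: I_def)
    then show ?thesis using R_fix inv[OF t] by (simp add: Q_def)
  qed
  obtain adj :: "('a \<Rightarrow>\<^sub>L 'a) \<Rightarrow> ('a \<Rightarrow>\<^sub>L 'a)"
    where adj: "bounded_linear adj" "\<And>T x y. adj T x \<bullet> y = x \<bullet> T y"
    using adjoint_blinfun_exists by blast
  define W where "W t = id_blinfun + (Q t - adj (Q t))" for t
  have CW: "C_on k I W"
    unfolding W_def
    by (rule C_on_affine[OF bounded_linear_sub[OF bounded_linear_ident adj(1)] CQ])
  have Wt0: "W t0 = id_blinfun"
  proof -
    have Q0: "Q t0 = orth_proj (V t0)"
      by (rule blinfun_eqI) (simp add: Q_def R_def inv[OF t0I])
    have "adj (Q t0) x = Q t0 x" for x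
    proof -
      have "adj (Q t0) x \<bullet> y = Q t0 x \<bullet> y" for y
        unfolding adj(2) Q0 by (simp add: inner_orth_proj_commute[OF V[OF t0]])
      then have "(adj (Q t0) x - Q t0 x) \<bullet> (adj (Q t0) x - Q t0 x) = 0"
        by (simp add: inner_diff_left)
      then show ?thesis by simp
    qed
    then show ?thesis unfolding W_def by (auto intro!: blinfun_eqI simp: blinfun.bilinear_simps)
  qed
  obtain d where d: "d > 0"
    and close: "\<And>t. t \<in> I \<inter> {t0 - d<..<t0 + d} \<Longrightarrow> norm (W t0 - W t) < 1"
    using C_on_imp_eventually_close[OF CW t0I, of 1] by auto
  define I' where "I' = J \<inter> {t0 - min d e<..<t0 + min d e}"
  have I': "t \<in> I" "t \<in> I \<inter> {t0 - d<..<t0 + d}" "t \<in> J" if "t \<in> I'" for t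
    using that by (auto simp: I'_def I_def)
  have "\<exists>Z. Z o\<^sub>L W t = id_blinfun \<and> W t o\<^sub>L Z = id_blinfun" if "t \<in> I'" for t
    using GL_near_identity[of "W t"] close[OF I'(2)[OF that]] unfolding Wt0 GL_def by blast
  then obtain Z where Z: "\<And>t. t \<in> I' \<Longrightarrow> Z t o\<^sub>L W t = id_blinfun"
      "\<And>t. t \<in> I' \<Longrightarrow> W t o\<^sub>L Z t = id_blinfun"
    by metis
  have sub: "I' \<subseteq> I" using I'(1) by blast
  have "C_on k I' (\<lambda>t. Q t o\<^sub>L Z t)"
    using C_on_bilinear[OF bounded_bilinear_blinfun_compose C_on_subset[OF CQ sub]
        C_on_inverse[OF C_on_subset[OF CW sub] Z]] .
  moreover have "orth_proj (V t) = Q t o\<^sub>L Z t" if t: "t \<in> I'" for t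
    using orth_proj_from_idempotent[OF V[OF I'(3)[OF t]] Q_in[OF I'(1)[OF t]]
        Q_fix[OF I'(1)[OF t]] adj(2)] Z(2)[OF t] by (simp add: W_def)
  ultimately have "C_on k I' (\<lambda>t. orth_proj (V t))"
    using C_on_cong[of I' "\<lambda>t. orth_proj (V t)" "\<lambda>t. Q t o\<^sub>L Z t"] by simp
  then show "\<exists>e>0. C_on k (J \<inter> {t0 - e<..<t0 + e}) (\<lambda>t. orth_proj (V t))"
    using d e unfolding I'_def by (intro exI[of _ "min d e"]) simp
qed

theorem proposition4p9:
  fixes V :: "real \<Rightarrow> 'a::{real_inner,complete_space} set"
    and J :: "real set"
    and k :: smoothness
  assumes "separable_space (euclidean :: 'a topology)"
    and "is_interval J"
    and "\<And>t. t \<in> J \<Longrightarrow> closed_subspace (V t)"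
  shows "C_family_closed_subspaces k J V \<longleftrightarrow> C_on k J (\<lambda>t. orth_proj (V t))"
  using family_imp_orth_proj_C_on[OF assms(2), of k V]
    orth_proj_C_on_imp_family[of J V k] assms(3) by blast

end
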